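(* Let $\lambda>-1/2$ and let $n\ge 1$ be an integer. Let $\mathcal{P}_n$ be the set of algebraic polynomials of degree at most $n$, let $$\|f\|:=\Big(\int_{-1}^{1}(1-t^2)^{\lambda-1/2}\,|f(t)|^2\,dt\Big)^{1/2},\qquad c_{n,\lambda}:=\sup_{f\in\mathcal{P}_n,\ f\neq 0}\frac{\|f'\|}{\|f\|}.$$ For $m\ge 1$ let $\nu_m$ and $\widetilde{\nu}_m$ denote the largest eigenvalues of the symmetric $m\times m$ matrices $\mathbf{A}_m$ and $\widetilde{\mathbf{A}}_m$, respectively, defined in the context. Then $$c_{n,\lambda}=\begin{cases}2\sqrt{\nu_m}, & \text{if } n=2m,\\ 2\sqrt{\widetilde{\nu}_{m+1}}, & \text{if } n=2m+1.\end{cases}$$ Moreover, if $p\in\mathcal{P}_n$, $p\neq 0$, is an extremal polynomial, i.e. $\|p'\|=c_{n,\lambda}\|p\|$, then there are $\theta\in\mathbb{R}$ and real numbers $t_{n-2k}$, $0\le k\le\lfloor (n-1)/2\rfloor$, with $t_n>0$ and $t_{n-2k}\ge 0$ for $1\le k\le\lfloor (n-1)/2\rfloor$, such that $$p(t)=e^{i\theta}\sum_{k=0}^{\lfloor (n-1)/2\rfloor}t_{n-2k}\,C_{n-2k}^{\lambda}(t).$$ In particular, $p$ is an even (resp. odd) polynomial if $n$ is even (resp. odd).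
   Context: Polynomials are taken with complex coefficients. $C_j^{\lambda}$ denotes the $j$-th Gegenbauer (ultraspherical) polynomial, orthogonal on $[-1,1]$ with weight $(1-t^2)^{\lambda-1/2}$, in the standard normalization; for $\lambda=0$ and $j\ge1$, use $C_j^{0}=\frac{2}{j}T_j$, where $T_j$ is the Chebyshev polynomial of the first kind. For integers $k\ge 1$ define the positive numbers $$\alpha_k=\Big(\frac{\Gamma(2k+2\lambda-1)(2k+\lambda-1)}{\Gamma(2k)}\Big)^{1/2},\qquad \beta_k=\Big(\frac{\Gamma(2k+1)(2k+\lambda)}{\Gamma(2k+2\lambda)}\Big)^{1/2},$$ $$\widetilde{\alpha}_k=\Big(\frac{\Gamma(2k+2\lambda-2)(2k+\lambda-2)}{\Gamma(2k-1)}\Big)^{1/2},\qquad \widetilde{\beta}_k=\Big(\frac{\Gamma(2k)(2k+\lambda-1)}{\Gamma(2k+2\lambda-1)}\Big)^{1/2},$$ where for $k=1$, $\lambda=0$ the expression $\Gamma(2\lambda)\lambda$ in $\widetilde\alpha_1$ is understood as its limiting value, i.e. $\lambda\Gamma(2\lambda)=\tfrac12\Gamma(2\lambda+1)$, equal to $\tfrac12$ at $\lambda=0$. For $m\ge 1$ let $\mathbf{C}_m$ be the upper triangular $m\times m$ matrix with $(k,j)$ entry $\alpha_k\beta_j$ for $k\le j$ and $0$ for $k>j$, and let $\widetilde{\mathbf{C}}_m$ be the upper triangular $m\times m$ matrix with $(k,j)$ entry $\widetilde\alpha_k\widetilde\beta_j$ for $k\le j$ and $0$ for $k>j$. Set $\mathbf{A}_m=\mathbf{C}_m^{\top}\mathbf{C}_m$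 and $\widetilde{\mathbf{A}}_m=\widetilde{\mathbf{C}}_m^{\top}\widetilde{\mathbf{C}}_m$. *)

theory Defs
  imports
    "HOL-Analysis.Analysis"
    "HOL-Computational_Algebra.Polynomial"
    "Jordan_Normal_Form.Spectral_Radius"
begin

text \<open>The norm of the weighted space; at \<open>\<plusminus>1\<close> the conventional value \<open>0 powr a = 0\<close> is irrelevant.\<close>

definition wnorm :: "real \<Rightarrow> complex poly \<Rightarrow> real" where
  "wnorm lam f =
     sqrt (LBINT t:{-1..1}. (1 - t\<^sup>2) powr (lam - 1/2) * (cmod (poly f (complex_of_real t)))\<^sup>2)"

text \<open>The supremum is taken in the extended reals, so that its finiteness is part of any
  claim that it equals a real number.\<close>

definition markov_const :: "nat \<Rightarrow> real \<Rightarrow> ereal" where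
  "markov_const n lam =
     (SUP f\<in>{f :: complex poly. degree f \<le> n \<and> f \<noteq> 0}. ereal (wnorm lam (pderiv f) / wnorm lam f))"

definition extremal_poly :: "nat \<Rightarrow> real \<Rightarrow> complex poly \<Rightarrow> bool" where
  "extremal_poly n lam p \<longleftrightarrow>
     degree p \<le> n \<and> p \<noteq> 0 \<and> ereal (wnorm lam (pderiv p)) = markov_const n lam * ereal (wnorm lam p)"

fun chebyshev_T :: "nat \<Rightarrow> real poly" where
  "chebyshev_T 0 = 1"
| "chebyshev_T (Suc 0) = [:0, 1:]"
| "chebyshev_T (Suc (Suc j)) = [:0, 2:] * chebyshev_T (Suc j) - chebyshev_T j"

lemma poly_chebyshev_T_cos: "poly (chebyshev_T j) (cos x) = cos (real j * x)"
proof (induction j rule: chebyshev_T.induct)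
  case (3 j)
  have "cos (real (j + 2) * x) + cos (real j * x) = 2 * cos x * cos (real (j + 1) * x)"
    using cos_add[of "real (j + 1) * x" x] cos_diff[of "real (j + 1) * x" x]
    by (simp add: algebra_simps)
  with 3 show ?case
    by (simp add: algebra_simps)
qed simp_all

text \<open>
  The standard normalization of the Gegenbauer polynomials, by the three-term recurrence
  \<open>j C\<^sub>j(t) = 2 (j + \<lambda> - 1) t C\<^sub>j\<^sub>-\<^sub>1(t) - (j + 2\<lambda> - 2) C\<^sub>j\<^sub>-\<^sub>2(t)\<close>; equivalently, the generating
  function is \<open>(1 - 2tz + z\<^sup>2) powr (-\<lambda>)\<close>. For \<open>\<lambda> = 0\<close> the recurrence yields \<open>0\<close> in every
  positive degree, whence the separate convention in \<open>gegenbauer\<close>.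
\<close>

fun gegenbauer_rec :: "real \<Rightarrow> nat \<Rightarrow> real poly" where
  "gegenbauer_rec lam 0 = 1"
| "gegenbauer_rec lam (Suc 0) = [:0, 2 * lam:]"
| "gegenbauer_rec lam (Suc (Suc j)) =
     Polynomial.smult (1 / real (j + 2))
       ([:0, 2 * (real (j + 2) + lam - 1):] * gegenbauer_rec lam (Suc j)
        - Polynomial.smult (real (j + 2) + 2 * lam - 2) (gegenbauer_rec lam j))"

definition gegenbauer :: "real \<Rightarrow> nat \<Rightarrow> real poly" where
  "gegenbauer lam j =
     (if lam = 0 \<and> j \<ge> 1 then Polynomial.smult (2 / real j) (chebyshev_T j) else gegenbauer_rec lam j)"

definition alpha :: "real \<Rightarrow> nat \<Rightarrow> real" where
  "alpha lam k =
     sqrt (Gamma (2 * real k + 2 * lam - 1) * (2 * real k + lam - 1) / Gamma (2 * real k))"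

definition beta :: "real \<Rightarrow> nat \<Rightarrow> real" where
  "beta lam k =
     sqrt (Gamma (2 * real k + 1) * (2 * real k + lam) / Gamma (2 * real k + 2 * lam))"

text \<open>
  For \<open>k = 1\<close>, \<open>\<lambda> = 0\<close> the numerator \<open>\<lambda> \<Gamma>(2\<lambda>)\<close> takes its limiting value \<open>1/2\<close>
  (whereas \<open>Gamma 0 = 0\<close> in the library).
\<close>

definition alpha_tilde :: "real \<Rightarrow> nat \<Rightarrow> real" where
  "alpha_tilde lam k =
     sqrt ((if k = 1 \<and> lam = 0 then 1/2
            else Gamma (2 * real k + 2 * lam - 2) * (2 * real k + lam - 2)) / Gamma (2 * real k - 1))"

definition beta_tilde :: "real \<Rightarrow> nat \<Rightarrow> real" where
  "beta_tilde lam k =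
     sqrt (Gamma (2 * real k) * (2 * real k + lam - 1) / Gamma (2 * real k + 2 * lam - 1))"

text \<open>Matrix indices start at \<open>0\<close>: row \<open>i\<close> and column \<open>j\<close> below are the mathematical row
  \<open>i + 1\<close> and column \<open>j + 1\<close>.\<close>

definition C_mat :: "real \<Rightarrow> nat \<Rightarrow> real mat" where
  "C_mat lam m =
     Matrix.mat m m (\<lambda>(i, j). if i \<le> j then alpha lam (i + 1) * beta lam (j + 1) else 0)"

definition C_tilde_mat :: "real \<Rightarrow> nat \<Rightarrow> real mat" where
  "C_tilde_mat lam m =
     Matrix.mat m m (\<lambda>(i, j). if i \<le> j then alpha_tilde lam (i + 1) * beta_tilde lam (j + 1) else 0)"

definition A_mat :: "real \<Rightarrow> nat \<Rightarrow> real mat" where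
  "A_mat lam m = transpose_mat (C_mat lam m) * C_mat lam m"

definition A_tilde_mat :: "real \<Rightarrow> nat \<Rightarrow> real mat" where
  "A_tilde_mat lam m = transpose_mat (C_tilde_mat lam m) * C_tilde_mat lam m"

definition nu :: "real \<Rightarrow> nat \<Rightarrow> real" where
  "nu lam m = Max (spectrum (A_mat lam m))"

definition nu_tilde :: "real \<Rightarrow> nat \<Rightarrow> real" where
  "nu_tilde lam m = Max (spectrum (A_tilde_mat lam m))"

end

theory Submission
  imports Defs
begin

text \<open>
  In the orthonormal basis of Gegenbauer polynomials, \<open>\<parallel>p'\<parallel>\<^sup>2 / 4\<close> is a Hermitian form in the
  coefficients whose matrix vanishes between indices of different parity, and on each parity class
  is real with positive entries \<open>G i j\<close>; on the class of \<open>n\<close> it is the matrix of the theorem.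
  Replacing the coefficients by their absolute values can only increase the form, and
  \<open>G i j < G (i + 1) (j + 1)\<close> shows that the opposite parity class contributes strictly less. Hence the
  supremum is the largest eigenvalue on the class of \<open>n\<close>. In the case of equality the absolute values
  form a nonnegative, hence positive, eigenvector, and all coefficients have the same argument.
\<close>

text \<open>The coefficient of D_k in the derivative of D_j depends on k alone, so within a parity
  class the expansions of the derivatives are nested. This gives the triangular factors their
  product entries, and it makes \<open>G i j\<close>, up to normalization, a function of min i j:
  the squared norm of the derivative of lower degree. A shift of the index by one then compares the
  two parity classes through ratios of consecutive norms, for which both kinds of norm are needed in
  closed form. For \<open>lam < 0\<close> every C_j of positive degree is a negative multiple of
  D_j; this common sign goes into the phase, so that the final coefficients are nonnegative for
  every \<open>lam > -1/2\<close>.\<close>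

section \<open>Rescaled Gegenbauer polynomials\<close>

text \<open>
  Dividing \<open>C\<^sub>k\<close> by \<open>\<lambda>\<close> for \<open>k \<ge> 1\<close> gives a family \<open>D\<^sub>k\<close> that is regular at \<open>\<lambda> = 0\<close> and has
  positive leading coefficients for all \<open>\<lambda> > -1/2\<close>. As \<open>D\<^sub>0 = 1\<close> is not divided by \<open>\<lambda>\<close>, the
  coefficients \<open>k + 2\<lambda>\<close> and \<open>2 (k + \<lambda>)\<close> both become \<open>2\<close> at \<open>k = 0\<close>.
\<close>

definition geg_gamma :: "real \<Rightarrow> nat \<Rightarrow> real" where
  "geg_gamma lam k = (if k = 0 then 2 else real k + 2 * lam)"

definition geg_c :: "real \<Rightarrow> nat \<Rightarrow> real" where
  "geg_c lam k = (if k = 0 then 2 else 2 * (real k + lam))"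

fun geg :: "real \<Rightarrow> nat \<Rightarrow> real poly" where
  "geg lam 0 = 1"
| "geg lam (Suc 0) = [:0, 2:]"
| "geg lam (Suc (Suc k)) =
     Polynomial.smult (1 / real (k + 2))
       ([:0, 2 * (real (k + 1) + lam):] * geg lam (Suc k) - Polynomial.smult (geg_gamma lam k) (geg lam k))"

text \<open>For \<open>lam\<close> nonzero the common factor passes through the recurrence as long
  as C_0 is not involved. Degree 2 is separate: C_0 = D_0 carries no factor, and the value 2 of
  \<open>geg_gamma\<close> at 0 compensates. For \<open>lam = 0\<close> the factors 2 / j turn the
  Chebyshev recurrence into that of \<open>geg 0\<close>.\<close>

lemma gegenbauer_eq_smult_geg:
  "gegenbauer lam (Suc k) = Polynomial.smult (if lam = 0 then 1 else lam) (geg lam (Suc k))"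
proof (cases "lam = 0")
  case True
  have "Polynomial.smult (2 / real (Suc k)) (chebyshev_T (Suc k)) = geg 0 (Suc k)"
  proof (induction k rule: less_induct)
    case (less k)
    consider "k = 0" | "k = 1" | j where "k = Suc (Suc j)"
      by (metis One_nat_def not0_implies_Suc)
    then show ?case
    proof cases
      case 3
      show ?thesis
      proof (rule poly_ext)
        fix x
        have 1: "2 / real (Suc (Suc j)) * poly (chebyshev_T (Suc (Suc j))) x = poly (geg 0 (Suc (Suc j))) x"
          using less.IH[of "Suc j"] 3 by (metis poly_smult lessI)
        have 2: "2 / real (Suc j) * poly (chebyshev_T (Suc j)) x = poly (geg 0 (Suc j)) x"
          using less.IH[of j] 3 by (metis poly_smult lessI less_SucI)
        show "poly (Polynomial.smult (2 / real (Suc k)) (chebyshev_T (Suc k))) x = poly (geg 0 (Suc k)) x"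
          unfolding 3 chebyshev_T.simps(3)[of "Suc j"] geg.simps(3)[of 0 "Suc j"]
            poly_smult poly_mult poly_diff poly_pCons poly_0 1[symmetric] 2[symmetric] geg_gamma_def
          by (simp del: chebyshev_T.simps add: divide_simps) (simp del: chebyshev_T.simps add: algebra_simps)
      qed
    qed (simp_all add: geg_gamma_def, simp add: numeral_2_eq_2 one_pCons)
  qed
  with True show ?thesis by (simp add: gegenbauer_def)
next
  case False
  have "gegenbauer_rec lam (Suc k) = Polynomial.smult lam (geg lam (Suc k))"
  proof (induction k rule: less_induct)
    case (less k)
    consider "k = 0" | "k = 1" | j where "k = Suc (Suc j)"
      by (metis One_nat_def not0_implies_Suc)
    then show ?case
    proof cases
      case 3
      have 1: "gegenbauer_rec lam (Suc (Suc j)) = Polynomial.smult lam (geg lam (Suc (Suc j)))"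
        using less.IH[of "Suc j"] 3 by simp
      have 2: "gegenbauer_rec lam (Suc j) = Polynomial.smult lam (geg lam (Suc j))"
        using less.IH[of j] 3 by simp
      show ?thesis
        unfolding 3 gegenbauer_rec.simps(3)[of lam "Suc j"] geg.simps(3)[of lam "Suc j"] 1 2
        by (rule poly_ext) (simp only: poly_smult poly_mult poly_diff poly_pCons poly_0 geg_gamma_def, simp add: field_simps)
    next
      case 2
      then show ?thesis
        by (simp add: geg_gamma_def algebra_simps)
    qed simp
  qed
  with False show ?thesis by (simp add: gegenbauer_def)
qed

section \<open>Relations between consecutive derivatives, and the differential equation\<close>

lemma geg_recurrence:
  "(real k + 2) * poly (geg lam (Suc (Suc k))) x
     = 2 * (real k + 1 + lam) * x * poly (geg lam (Suc k)) x - geg_gamma lam k * poly (geg lam k) x"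
  by (simp add: field_simps)

lemma pderiv_geg_recurrence:
  "(real k + 2) * poly (pderiv (geg lam (Suc (Suc k)))) x
     = 2 * (real k + 1 + lam) * (poly (geg lam (Suc k)) x + x * poly (pderiv (geg lam (Suc k))) x)
       - geg_gamma lam k * poly (pderiv (geg lam k)) x"
  by (simp add: pderiv_smult pderiv_mult pderiv_diff pderiv_pCons) (simp add: field_simps)

text \<open>The exceptional value of \<open>geg_gamma\<close> at 0 is invisible here because D_0 is
  constant.\<close>

lemma gamma_pderiv_geg:
  "geg_gamma lam k * poly (pderiv (geg lam k)) x = (real k + 2 * lam) * poly (pderiv (geg lam k)) x"
  by (cases k) (simp_all add: geg_gamma_def)

text \<open>The two relations need a joint induction: differentiating the recurrence and eliminating
  \<open>E0\<close> by the first one yields the second one for k + 1, and from this, both hypotheses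
  and the recurrence yield the first one for k + 1.\<close>

lemma pderiv_geg_contiguous:
  "x * poly (pderiv (geg lam (Suc k))) x - poly (pderiv (geg lam k)) x = (real k + 1) * poly (geg lam (Suc k)) x"
  "poly (pderiv (geg lam (Suc k))) x - x * poly (pderiv (geg lam k)) x = geg_gamma lam k * poly (geg lam k) x"
proof (induction k)
  case 0
  { case 1 show ?case by (simp add: pderiv_pCons) }
  { case 2 show ?case by (simp add: pderiv_pCons geg_gamma_def) }
next
  case (Suc k)
  define D0 D1 D2 E0 E1 E2 where
    "D0 = poly (geg lam k) x" "D1 = poly (geg lam (Suc k)) x" "D2 = poly (geg lam (Suc (Suc k))) x"
    "E0 = poly (pderiv (geg lam k)) x" "E1 = poly (pderiv (geg lam (Suc k))) x"
    "E2 = poly (pderiv (geg lam (Suc (Suc k)))) x"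
  note defs = this
  have b: "x * E1 - E0 = (real k + 1) * D1" and c: "E1 - x * E0 = geg_gamma lam k * D0"
    using Suc unfolding defs by auto
  have r: "(real k + 2) * D2 = 2 * (real k + 1 + lam) * x * D1 - geg_gamma lam k * D0"
    unfolding defs by (rule geg_recurrence)
  have "(real k + 2) * E2 = 2 * (real k + 1 + lam) * (D1 + x * E1) - geg_gamma lam k * E0"
    unfolding defs by (rule pderiv_geg_recurrence)
  also have "geg_gamma lam k * E0 = (real k + 2 * lam) * E0"
    unfolding defs by (rule gamma_pderiv_geg)
  also have "E0 = x * E1 - (real k + 1) * D1" using b by simp
  finally have "(real k + 2) * E2 = (real k + 2) * (x * E1 + (real k + 1 + 2 * lam) * D1)"
    by (simp add: algebra_simps)
  then have e: "E2 = x * E1 + (real k + 1 + 2 * lam) * D1" by simp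
  have "x * E0 = x * (x * E1 - (real k + 1) * D1)" using b by simp
  then have f: "x * E2 - E1 = (real k + 2) * D2"
    using e r c by (simp add: algebra_simps)
  { case 1 show ?case using f unfolding defs by (simp add: add.commute) }
  { case 2 show ?case using e unfolding defs geg_gamma_def by (simp del: geg.simps add: algebra_simps) }
qed

text \<open>Add the first contiguous relation for k to the second one for k + 1.\<close>

lemma pderiv_geg_Suc_Suc:
  "pderiv (geg lam (Suc (Suc k))) = pderiv (geg lam k) + Polynomial.smult (geg_c lam (Suc k)) (geg lam (Suc k))"
  by (rule poly_ext)
    (use pderiv_geg_contiguous(1)[where k=k and lam=lam] pderiv_geg_contiguous(2)[where k="Suc k" and lam=lam] in
      \<open>simp del: geg.simps add: geg_c_def geg_gamma_def algebra_simps\<close>)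

lemma geg_ode:
  "[:1, 0, -1:] * pderiv (pderiv (geg lam k)) - [:0, 2 * lam + 1:] * pderiv (geg lam k)
     = Polynomial.smult (- (real k * (real k + 2 * lam))) (geg lam k)"
proof (cases k)
  case 0
  then show ?thesis by simp
next
  case (Suc j)
  \<comment> \<open>The second contiguous relation minus x times the first. Differentiating it once
    more and eliminating the derivative of D_j gives the equation.\<close>
  have "[:1, 0, -1:] * pderiv (geg lam k) = Polynomial.smult (geg_gamma lam j) (geg lam j) - [:0, real k:] * geg lam k"
  proof (rule poly_ext)
    fix x
    have "x * (x * poly (pderiv (geg lam (Suc j))) x - poly (pderiv (geg lam j)) x)
        = x * ((real j + 1) * poly (geg lam (Suc j)) x)"
      by (simp only: pderiv_geg_contiguous)
    then show "poly ([:1, 0, -1:] * pderiv (geg lam k)) x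
        = poly (Polynomial.smult (geg_gamma lam j) (geg lam j) - [:0, real k:] * geg lam k) x"
      using pderiv_geg_contiguous(2)[of lam j x] by (simp del: geg.simps add: Suc algebra_simps)
  qed
  then have "pderiv ([:1, 0, -1:] * pderiv (geg lam k))
      = pderiv (Polynomial.smult (geg_gamma lam j) (geg lam j) - [:0, real k:] * geg lam k)"
    by simp
  then have *: "(1 - x\<^sup>2) * poly (pderiv (pderiv (geg lam k))) x - 2 * x * poly (pderiv (geg lam k)) x
     = geg_gamma lam j * poly (pderiv (geg lam j)) x - real k * poly (geg lam k) x
        - real k * x * poly (pderiv (geg lam k)) x" for x
    unfolding pderiv_mult pderiv_diff pderiv_smult
    by (drule_tac arg_cong[where f = "\<lambda>p. poly p x"])
       (simp add: pderiv_pCons algebra_simps power2_eq_square)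
  show ?thesis
  proof (rule poly_ext)
    fix x
    have "(1 - x\<^sup>2) * poly (pderiv (pderiv (geg lam k))) x - (2 * lam + 1) * x * poly (pderiv (geg lam k)) x
        = - (real k * (real k + 2 * lam)) * poly (geg lam k) x"
    proof -
      have "poly (pderiv (geg lam j)) x = x * poly (pderiv (geg lam k)) x - real k * poly (geg lam k) x"
        using pderiv_geg_contiguous(1)[of x lam j] Suc by (simp del: geg.simps add: algebra_simps)
      then have "geg_gamma lam j * poly (pderiv (geg lam j)) x
          = (real j + 2 * lam) * (x * poly (pderiv (geg lam k)) x - real k * poly (geg lam k) x)"
        using gamma_pderiv_geg[of lam j x] by simp
      then show ?thesis
        using *[of x] Suc by (simp del: geg.simps add: algebra_simps power2_eq_square)
    qed
    then show "poly ([:1, 0, -1:] * pderiv (pderiv (geg lam k)) - [:0, 2 * lam + 1:] * pderiv (geg lam k)) x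
       = poly (Polynomial.smult (- (real k * (real k + 2 * lam))) (geg lam k)) x"
      by (simp add: algebra_simps power2_eq_square)
  qed
qed

text \<open>Telescoping in steps of two; the absence of j from the coefficients is what makes the
  index sets nested.\<close>

lemma pderiv_geg:
  "pderiv (geg lam j) = (\<Sum>k\<in>{k. k < j \<and> odd (j - k)}. Polynomial.smult (geg_c lam k) (geg lam k))"
proof (induction j rule: less_induct)
  case (less j)
  consider "j = 0" | "j = 1" | i where "j = Suc (Suc i)"
    by (metis One_nat_def not0_implies_Suc)
  then show ?case
  proof cases
    case 2
    then have "{k. k < j \<and> odd (j - k)} = {0}" by auto
    then show ?thesis using 2 by (simp add: geg_c_def pderiv_pCons)
  next
    case 3
    then have "{k. k < j \<and> odd (j - k)} = insert (Suc i) {k. k < i \<and> odd (i - k)}"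
      by (auto simp: less_Suc_eq Suc_diff_le)
    then show ?thesis
      using less.IH[of i] 3 pderiv_geg_Suc_Suc[of lam i] by (simp del: geg.simps add: add.commute)
  qed simp
qed

lemma poly_geg_minus: "poly (geg lam k) (- x) = (- 1) ^ k * poly (geg lam k) x"
  by (induction lam k rule: geg.induct) (simp_all add: field_simps)

section \<open>Integration against the weight\<close>

definition geg_int :: "real \<Rightarrow> real poly \<Rightarrow> real" where
  "geg_int lam f = (LBINT t:{-1..1}. (1 - t\<^sup>2) powr (lam - 1/2) * poly f t)"

text \<open>The Beta integral under the affine map of [-1,1] onto [0,1]. The closed value settles at
  once the integrability at the endpoints, where the weight is singular for
  \<open>lam < 1/2\<close>, and the positivity of the total mass.\<close>

lemma geg_weight_has_integral:
  assumes "lam > - 1/2"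
  shows "((\<lambda>t::real. (1 - t\<^sup>2) powr (lam - 1/2)) has_integral
           (4 powr (lam - 1/2) * 2 * Beta (lam + 1/2) (lam + 1/2))) {-1..1}"
proof -
  have "((\<lambda>t. t powr (lam - 1/2) * (1 - t) powr (lam - 1/2)) has_integral Beta (lam + 1/2) (lam + 1/2)) (cbox 0 1)"
    using has_integral_Beta_real[of "lam + 1/2" "lam + 1/2"] assms by simp
  from has_integral_affinity'[OF this, of "1/2" "1/2"]
  have "((\<lambda>x. ((1 + x) / 2) powr (lam - 1/2) * ((1 - x) / 2) powr (lam - 1/2)) has_integral
          2 * Beta (lam + 1/2) (lam + 1/2)) {-1..1}"
    by (simp add: field_simps)
  from has_integral_mult_right[OF this, of "4 powr (lam - 1/2)"]
  have "((\<lambda>x. 4 powr (lam - 1/2) * (((1 + x) / 2) powr (lam - 1/2) * ((1 - x) / 2) powr (lam - 1/2))) has_integral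
          4 powr (lam - 1/2) * 2 * Beta (lam + 1/2) (lam + 1/2)) {-1..1}"
    by (simp only: mult.assoc)
  moreover have "4 powr (lam - 1/2) * (((1 + x) / 2) powr (lam - 1/2) * ((1 - x) / 2) powr (lam - 1/2))
      = (1 - x\<^sup>2) powr (lam - 1/2)" if "x \<in> {-1..1}" for x :: real
  proof -
    have "1 - x\<^sup>2 = 4 * ((1 + x) / 2 * ((1 - x) / 2))"
      by (simp add: field_simps power2_eq_square)
    then show ?thesis using that by (simp only: powr_mult)
  qed
  ultimately show ?thesis by (rule has_integral_eq[rotated])
qed

lemma geg_weight_integrable:
  assumes "lam > - 1/2"
  shows "set_integrable lborel {-1..1} (\<lambda>t::real. (1 - t\<^sup>2) powr (lam - 1/2))"
proof -
  have "(\<lambda>t::real. (1 - t\<^sup>2) powr (lam - 1/2)) absolutely_integrable_on {-1..1}"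
    using geg_weight_has_integral[OF assms]
    by (intro nonnegative_absolutely_integrable_1) (auto simp: has_integral_integrable)
  then show ?thesis
    unfolding set_integrable_def by (subst (asm) integrable_completion) auto
qed

lemma geg_int_integrable:
  assumes "lam > - 1/2"
  shows "set_integrable lborel {-1..1} (\<lambda>t::real. (1 - t\<^sup>2) powr (lam - 1/2) * poly f t)"
proof -
  have "bounded ((\<lambda>t. poly f t) ` {-1..1})"
    by (intro compact_imp_bounded compact_continuous_image continuous_intros) auto
  then obtain B where B: "\<bar>poly f t\<bar> \<le> B" if "t \<in> {-1..1}" for t
    unfolding bounded_iff by (metis image_eqI real_norm_def)
  have [measurable]: "(\<lambda>t. poly f t) \<in> borel_measurable borel"
    by (intro borel_measurable_continuous_onI continuous_intros)
  have "set_integrable lborel {-1..1} (\<lambda>t::real. B * (1 - t\<^sup>2) powr (lam - 1/2))"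
    using geg_weight_integrable[OF assms] by simp
  then show ?thesis
  proof (rule set_integrable_bound)
    show "set_borel_measurable lborel {-1..1} (\<lambda>t. (1 - t\<^sup>2) powr (lam - 1/2) * poly f t)"
      unfolding set_borel_measurable_def by measurable
    show "AE x in lborel. x \<in> {-1..1} \<longrightarrow> norm ((1 - x\<^sup>2) powr (lam - 1/2) * poly f x)
            \<le> norm (B * (1 - x\<^sup>2) powr (lam - 1/2))"
    proof (intro AE_I2 impI)
      fix x :: real assume "x \<in> {-1..1}"
      then have "\<bar>poly f x\<bar> \<le> \<bar>B\<bar>" using B by (meson abs_ge_self order_trans)
      then show "norm ((1 - x\<^sup>2) powr (lam - 1/2) * poly f x) \<le> norm (B * (1 - x\<^sup>2) powr (lam - 1/2))"
        by (simp add: abs_mult mult.commute mult_right_mono)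
    qed
  qed
qed

lemma geg_int_one_pos:
  assumes "lam > - 1/2"
  shows "geg_int lam 1 > 0"
proof -
  have "geg_int lam 1 = 4 powr (lam - 1/2) * 2 * Beta (lam + 1/2) (lam + 1/2)"
    using set_borel_integral_eq_integral(2)[OF geg_weight_integrable[OF assms]]
      geg_weight_has_integral[OF assms]
    by (simp add: geg_int_def integral_unique)
  also have "\<dots> > 0"
    using assms by (auto simp: Beta_def intro!: mult_pos_pos divide_pos_pos Gamma_real_pos)
  finally show ?thesis .
qed

lemma geg_int_add:
  assumes "lam > - 1/2"
  shows "geg_int lam (f + g) = geg_int lam f + geg_int lam g"
  using set_integral_add(2)[OF geg_int_integrable[OF assms] geg_int_integrable[OF assms], of f g]
  by (simp add: geg_int_def distrib_left)

lemma geg_int_smult: "geg_int lam (Polynomial.smult c f) = c * geg_int lam f"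
  by (simp add: geg_int_def mult.left_commute flip: set_integral_mult_right)

lemma geg_int_zero [simp]: "geg_int lam 0 = 0"
  by (simp add: geg_int_def)

lemma geg_int_sum:
  assumes "lam > - 1/2"
  shows "geg_int lam (sum F A) = (\<Sum>i\<in>A. geg_int lam (F i))"
  by (induction A rule: infinite_finite_induct) (simp_all add: geg_int_add[OF assms])

lemma geg_int_diff:
  assumes "lam > - 1/2"
  shows "geg_int lam (f - g) = geg_int lam f - geg_int lam g"
  using geg_int_add[OF assms, of f "- g"] geg_int_smult[of lam "-1" g] by simp

text \<open>The integrand is the derivative of (1 - t^2) powr (lam + 1/2) times f. This function is
  continuous and vanishes at both endpoints because lam + 1/2 > 0, but it may fail to be
  differentiable there, hence the interior form of the fundamental theorem.\<close>

lemma geg_int_by_parts: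
  assumes "lam > - 1/2"
  shows "geg_int lam ([:1, 0, -1:] * pderiv f - [:0, 2 * lam + 1:] * f) = 0"
proof -
  let ?F = "\<lambda>t::real. (1 - t\<^sup>2) powr (lam + 1/2) * poly f t"
  let ?f = "\<lambda>t::real. (1 - t\<^sup>2) powr (lam - 1/2) * poly ([:1, 0, -1:] * pderiv f - [:0, 2 * lam + 1:] * f) t"
  have "(?f has_integral (?F 1 - ?F (-1))) {-1..1}"
  proof (rule fundamental_theorem_of_calculus_interior)
    have "1 - t\<^sup>2 \<ge> 0" if "t \<in> {-1..1}" for t :: real
      using that by (simp add: abs_square_le_1 abs_le_iff)
    then show "continuous_on {-1..1} ?F"
      using assms by (intro continuous_intros continuous_on_powr') auto
    fix t :: real assume t: "t \<in> {-1<..<1}"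
    then have pos: "1 - t\<^sup>2 > 0" by (simp add: abs_square_less_1 abs_less_iff)
    then have p: "(1 - t\<^sup>2) powr (lam + 1/2) = (1 - t\<^sup>2) powr (lam - 1/2) * (1 - t\<^sup>2)"
      using powr_add[of "1 - t\<^sup>2" "lam - 1/2" 1] by (simp add: algebra_simps)
    have "(?F has_real_derivative ?f t) (at t)"
      using pos
      by (auto intro!: derivative_eq_intros simp: p) (simp add: powr_diff field_simps power2_eq_square p)
    then show "(?F has_vector_derivative ?f t) (at t)"
      by (simp add: has_real_derivative_iff_has_vector_derivative)
  qed simp
  then have "(?f has_integral 0) {-1..1}" by simp
  then show ?thesis
    unfolding geg_int_def set_borel_integral_eq_integral(2)[OF geg_int_integrable[OF assms]]
    by (rule integral_unique)
qed

section \<open>Quadratic forms and the largest eigenvalue\<close>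

definition quad :: "('a \<Rightarrow> 'a \<Rightarrow> real) \<Rightarrow> 'a set \<Rightarrow> ('a \<Rightarrow> real) \<Rightarrow> real" where
  "quad G I y = (\<Sum>i\<in>I. \<Sum>j\<in>I. G i j * y i * y j)"

text \<open>Vectors are functions on the whole type; pinning them to 0 outside I places the sphere
  as a closed subset in a product of compact sets, and Tychonoff applies.\<close>

lemma compact_unit_sphere_fun:
  fixes I :: "'a set"
  assumes "finite I"
  shows "compact {y :: 'a \<Rightarrow> real. (\<forall>i. i \<notin> I \<longrightarrow> y i = 0) \<and> (\<Sum>i\<in>I. (y i)\<^sup>2) = 1}" (is "compact ?S")
proof -
  let ?B = "PiE UNIV (\<lambda>i. if i \<in> I then {-1..1} else {0}) :: ('a \<Rightarrow> real) set"
  have "compactin (product_topology (\<lambda>i. euclidean) UNIV) ?B"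
    by (simp add: compactin_PiE)
  then have "compact ?B"
    by (simp add: euclidean_product_topology)
  moreover have "closed {y :: 'a \<Rightarrow> real. (\<Sum>i\<in>I. (y i)\<^sup>2) = 1}"
    by (intro closed_Collect_eq continuous_intros) simp_all
  ultimately have "compact (?B \<inter> {y. (\<Sum>i\<in>I. (y i)\<^sup>2) = 1})"
    by (rule compact_Int_closed)
  also have "?B \<inter> {y. (\<Sum>i\<in>I. (y i)\<^sup>2) = 1} = ?S"
  proof -
    have "y i \<in> {-1..1}" if "(\<Sum>i\<in>I. (y i)\<^sup>2) = 1" "i \<in> I" for y :: "'a \<Rightarrow> real" and i
      using member_le_sum[of i I "\<lambda>i. (y i)\<^sup>2"] that assms by (simp add: abs_square_le_1 abs_le_iff)
    moreover have "(y i \<in> (if i \<in> I then {-1..1} else {0})) \<longleftrightarrow> (i \<in> I \<longrightarrow> y i \<in> {-1..1}) \<and> (i \<notin> I \<longrightarrow> y i = 0)"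
      for y :: "'a \<Rightarrow> real" and i
      by simp
    ultimately show ?thesis
      unfolding set_eq_iff Int_iff PiE_iff extensional_UNIV mem_Collect_eq by blast
  qed
  finally show ?thesis .
qed

lemma quad_scale: "quad G I (\<lambda>i. c * y i) = c\<^sup>2 * quad G I y"
  unfolding quad_def sum_distrib_left by (intro sum.cong) (simp_all add: power2_eq_square mult_ac)

lemma quad_max_exists:
  assumes "finite I" "I \<noteq> {}"
  obtains M y where "(\<Sum>i\<in>I. (y i)\<^sup>2) = 1" "quad G I y = M"
    "\<And>z. quad G I z \<le> M * (\<Sum>i\<in>I. (z i)\<^sup>2)"
proof -
  let ?S = "{y :: 'a \<Rightarrow> real. (\<forall>i. i \<notin> I \<longrightarrow> y i = 0) \<and> (\<Sum>i\<in>I. (y i)\<^sup>2) = 1}"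
  obtain k where k: "k \<in> I" using assms by auto
  have "(\<Sum>i\<in>I. (if i = k then 1 else 0 :: real)\<^sup>2) = (\<Sum>i\<in>I. if i = k then 1 else 0)"
    by (intro sum.cong) auto
  also have "\<dots> = 1"
    using k assms(1) by (simp only: sum.delta if_True)
  finally have one: "(\<Sum>i\<in>I. (if i = k then 1 else 0 :: real)\<^sup>2) = 1" .
  have "(\<lambda>i. if i = k then 1 else 0) \<in> ?S"
  proof (intro CollectI conjI allI impI one)
    fix i assume "i \<notin> I"
    then show "(if i = k then 1 else 0 :: real) = 0" using k by (cases "i = k") simp_all
  qed
  then have "?S \<noteq> {}" by (metis (no_types, lifting) empty_iff)
  moreover have "continuous_on ?S (quad G I)"
    unfolding quad_def
    by (intro continuous_intros continuous_on_subset[OF continuous_on_product_coordinates]) simp_all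
  ultimately have "\<exists>y\<in>?S. \<forall>z\<in>?S. quad G I z \<le> quad G I y"
    by (rule continuous_attains_sup[OF compact_unit_sphere_fun[OF assms(1)]])
  then obtain y where y: "y \<in> ?S" and max: "\<And>z. z \<in> ?S \<Longrightarrow> quad G I z \<le> quad G I y"
    by (elim bexE) (rule that, auto)
  have "quad G I z \<le> quad G I y * (\<Sum>i\<in>I. (z i)\<^sup>2)" for z
  proof (cases "(\<Sum>i\<in>I. (z i)\<^sup>2) = 0")
    case True
    then have "\<forall>i\<in>I. z i = 0" using assms by (simp add: sum_nonneg_eq_0_iff)
    then have "quad G I z = 0" by (simp add: quad_def)
    with True show ?thesis by simp
  next
    case False
    define s where "s = (\<Sum>i\<in>I. (z i)\<^sup>2)"
    have s: "s > 0" using False sum_nonneg[of I "\<lambda>i. (z i)\<^sup>2"] unfolding s_def by (simp add: less_le)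
    let ?u = "\<lambda>i. if i \<in> I then (1 / sqrt s) * z i else 0"
    have "?u \<in> ?S"
      using s by (auto simp: power_mult_distrib power_divide s_def[symmetric] simp flip: sum_divide_distrib)
    then have "quad G I ?u \<le> quad G I y" by (rule max)
    moreover have "quad G I ?u = quad G I (\<lambda>i. (1 / sqrt s) * z i)"
      unfolding quad_def by (intro sum.cong) simp_all
    ultimately have "(1 / sqrt s)\<^sup>2 * quad G I z \<le> quad G I y"
      by (simp only: quad_scale)
    then show ?thesis using s by (simp add: power_divide s_def[symmetric] field_simps)
  qed
  with y show ?thesis by (intro that) auto
qed

text \<open>Moving the maximiser by s in the k-th coordinate changes the form minus M times the
  squared norm by a * s^2 + b * s, which must be nonpositive for all s. Hence b = 0, which is the
  k-th eigenvalue equation.\<close>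

lemma quad_max_eigen:
  assumes "finite I" and sym: "\<And>i j. i \<in> I \<Longrightarrow> j \<in> I \<Longrightarrow> G i j = G j i"
    and max: "\<And>z. quad G I z \<le> M * (\<Sum>i\<in>I. (z i)\<^sup>2)"
    and eq: "quad G I y = M * (\<Sum>i\<in>I. (y i)\<^sup>2)" and k: "k \<in> I"
  shows "(\<Sum>j\<in>I. G k j * y j) = M * y k"
proof -
  define b where "b = 2 * ((\<Sum>j\<in>I. G k j * y j) - M * y k)"
  define a where "a = G k k - M"
  have *: "a * s\<^sup>2 + b * s \<le> 0" for s
  proof -
    let ?d = "\<lambda>i. if i = k then s else (0::real)"
    have d: "(\<Sum>i\<in>I. ?d i * X i) = s * X k" for X
      using assms(1) k sum.delta[of I k "\<lambda>i. s * X i"] by (simp add: if_distrib[of "\<lambda>x. x * _"] cong: if_cong)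
    have "(\<Sum>i\<in>I. (y i + ?d i)\<^sup>2) = (\<Sum>i\<in>I. (y i)\<^sup>2 + ?d i * (2 * y i + s))"
      by (intro sum.cong) (auto simp: power2_eq_square algebra_simps)
    then have 1: "(\<Sum>i\<in>I. (y i + ?d i)\<^sup>2) = (\<Sum>i\<in>I. (y i)\<^sup>2) + 2 * s * y k + s\<^sup>2"
      unfolding sum.distrib d by (simp add: power2_eq_square algebra_simps)
    have s: "(\<Sum>i\<in>I. y i * G i k) = (\<Sum>i\<in>I. G k i * y i)"
      using sym k by (intro sum.cong) auto
    have "quad G I (\<lambda>i. y i + ?d i) = (\<Sum>i\<in>I. (y i + ?d i) * ((\<Sum>j\<in>I. G i j * y j) + (\<Sum>j\<in>I. ?d j * G i j)))"
      unfolding quad_def sum.distrib[symmetric] sum_distrib_left by (intro sum.cong) (simp_all only: algebra_simps)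
    also have "\<dots> = (\<Sum>i\<in>I. y i * (\<Sum>j\<in>I. G i j * y j)) + s * (\<Sum>i\<in>I. y i * G i k)
        + (s * (\<Sum>j\<in>I. G k j * y j) + s\<^sup>2 * G k k)"
      unfolding d distrib_right sum.distrib by (simp add: sum_distrib_left distrib_left sum.distrib power2_eq_square mult.left_commute)
    also have "(\<Sum>i\<in>I. y i * (\<Sum>j\<in>I. G i j * y j)) = quad G I y"
      unfolding quad_def by (simp add: sum_distrib_left mult_ac)
    finally show ?thesis
      using max[of "\<lambda>i. y i + ?d i"] unfolding eq 1 s a_def b_def by (simp add: algebra_simps)
  qed
  have "b = 0"
  proof (rule ccontr)
    assume "b \<noteq> 0"
    \<comment> \<open>With this s the value becomes s^2 * (a + 1 + |a|), which is positive whatever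
      the sign of a.\<close>
    define s where "s = b / (1 + \<bar>a\<bar>)"
    have "b = s * (1 + \<bar>a\<bar>)" unfolding s_def by simp
    then have "a * s\<^sup>2 + b * s = s\<^sup>2 * (a + (1 + \<bar>a\<bar>))"
      by (simp add: algebra_simps power2_eq_square)
    also have "\<dots> > 0" using \<open>b \<noteq> 0\<close> unfolding s_def by (intro mult_pos_pos) auto
    finally show False using *[of s] by simp
  qed
  then show ?thesis by (simp add: b_def)
qed

text \<open>A maximiser of the form on the sphere is an eigenvector for M, and every eigenvalue is
  the Rayleigh quotient of its eigenvector, hence at most M. The map \<open>e\<close> translates
  between matrix positions and elements of I.\<close>

lemma Max_spectrum_quad:
  fixes e :: "nat \<Rightarrow> 'a"
  assumes "m > 0" and inj: "inj_on e {..<m}" and I: "I = e ` {..<m}"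
    and sym: "\<And>i j. i \<in> I \<Longrightarrow> j \<in> I \<Longrightarrow> G i j = G j i"
    and A: "A = Matrix.mat m m (\<lambda>(i, j). G (e i) (e j))"
  shows "quad G I z \<le> Max (spectrum A) * (\<Sum>i\<in>I. (z i)\<^sup>2)"
    and "\<exists>y. (\<Sum>i\<in>I. (y i)\<^sup>2) = 1 \<and> quad G I y = Max (spectrum A)"
proof -
  have fin: "finite I" "I \<noteq> {}" using I \<open>m > 0\<close> by auto
  obtain M y where y: "(\<Sum>i\<in>I. (y i)\<^sup>2) = 1" "quad G I y = M"
    and M: "\<And>z. quad G I z \<le> M * (\<Sum>i\<in>I. (z i)\<^sup>2)"
    using quad_max_exists[OF fin] by metis
  have mult: "(A *\<^sub>v v) $ i = (\<Sum>j<m. G (e i) (e j) * v $ j)" if "i < m" "v \<in> carrier_vec m" for v i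
    using that by (simp add: A scalar_prod_def lessThan_atLeast0)
  have carr: "A \<in> carrier_mat m m" by (simp add: A)
  have "M \<in> spectrum A"
  proof -
    let ?v = "Matrix.vec m (\<lambda>i. y (e i))"
    have "(A *\<^sub>v ?v) $ i = M * y (e i)" if "i < m" for i
    proof -
      have "(A *\<^sub>v ?v) $ i = (\<Sum>j<m. G (e i) (e j) * y (e j))"
        using that by (simp add: mult)
      also have "\<dots> = (\<Sum>j\<in>I. G (e i) j * y j)"
        unfolding I by (simp add: sum.reindex[OF inj])
      also have "\<dots> = M * y (e i)"
        using that I y by (intro quad_max_eigen[OF fin(1) sym M]) simp_all
      finally show ?thesis .
    qed
    then have "A *\<^sub>v ?v = M \<cdot>\<^sub>v ?v"
      using carr by (intro eq_vecI) auto
    moreover have "?v \<noteq> 0\<^sub>v m"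
    proof
      assume "?v = 0\<^sub>v m"
      then have "y (e i) = 0" if "i < m" for i
        using that by (metis index_vec index_zero_vec(1))
      then have "(\<Sum>i\<in>I. (y i)\<^sup>2) = 0" unfolding I by (intro sum.neutral) auto
      with y show False by simp
    qed
    ultimately show ?thesis
      using carr unfolding spectrum_def eigenvalue_def eigenvector_def
      by (intro CollectI exI[of _ ?v]) auto
  qed
  moreover have "x \<le> M" if x: "x \<in> spectrum A" for x
  proof -
    obtain v where v: "v \<in> carrier_vec m" "v \<noteq> 0\<^sub>v m" "A *\<^sub>v v = x \<cdot>\<^sub>v v"
      using x carr unfolding spectrum_def eigenvalue_def eigenvector_def by auto
    define z where "z = (\<lambda>a. v $ (inv_into {..<m} e a))"
    have z: "z (e i) = v $ i" if "i < m" for i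
      using that inj by (simp add: z_def)
    have "quad G I z = (\<Sum>i<m. \<Sum>j<m. G (e i) (e j) * v $ i * v $ j)"
      unfolding quad_def I by (simp add: sum.reindex[OF inj] z)
    also have "\<dots> = (\<Sum>i<m. v $ i * (A *\<^sub>v v) $ i)"
      by (intro sum.cong refl) (simp add: mult[OF _ v(1)] sum_distrib_left mult_ac)
    also have "\<dots> = x * (\<Sum>i<m. (v $ i)\<^sup>2)"
      using v by (simp add: sum_distrib_left power2_eq_square algebra_simps)
    finally have 1: "quad G I z = x * (\<Sum>i<m. (v $ i)\<^sup>2)" .
    have 2: "(\<Sum>i\<in>I. (z i)\<^sup>2) = (\<Sum>i<m. (v $ i)\<^sup>2)"
      unfolding I by (simp add: sum.reindex[OF inj] z)
    have "(\<Sum>i<m. (v $ i)\<^sup>2) \<noteq> 0"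
    proof
      assume "(\<Sum>i<m. (v $ i)\<^sup>2) = 0"
      then have "\<forall>i<m. v $ i = 0" by (simp add: sum_nonneg_eq_0_iff)
      then have "v = 0\<^sub>v m" using v by (intro eq_vecI) auto
      with v show False by simp
    qed
    then have "(\<Sum>i<m. (v $ i)\<^sup>2) > 0"
      by (simp add: sum_nonneg less_le)
    then show ?thesis using M[of z] unfolding 1 2 by simp
  qed
  ultimately have "Max (spectrum A) = M"
    using card_finite_spectrum(1)[OF carr] by (intro Max_eqI) auto
  then show "quad G I z \<le> Max (spectrum A) * (\<Sum>i\<in>I. (z i)\<^sup>2)"
    and "\<exists>y. (\<Sum>i\<in>I. (y i)\<^sup>2) = 1 \<and> quad G I y = Max (spectrum A)"
    using M y by auto
qed

text \<open>
  Nonnegativity of the maximiser is assumed here; for the extremal polynomial it comes for free,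
  since the maximiser is the vector of absolute values of its coefficients.
\<close>

lemma perron_positive:
  assumes fin: "finite I" and sym: "\<And>i j. i \<in> I \<Longrightarrow> j \<in> I \<Longrightarrow> G i j = G j i"
    and pos: "\<And>i j. i \<in> I \<Longrightarrow> j \<in> I \<Longrightarrow> G i j > 0"
    and max: "\<And>z. quad G I z \<le> M * (\<Sum>i\<in>I. (z i)\<^sup>2)"
    and eq: "quad G I y = M * (\<Sum>i\<in>I. (y i)\<^sup>2)"
    and nonneg: "\<And>i. i \<in> I \<Longrightarrow> y i \<ge> 0" and nz: "\<exists>i\<in>I. y i \<noteq> 0" and k: "k \<in> I"
  shows "y k > 0"
proof -
  obtain l where l: "l \<in> I" "y l \<noteq> 0" using nz by blast
  \<comment> \<open>One nonzero coordinate makes every row sum of \<open>G\<close> against y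
    positive; that sum is M * y k, so y k cannot vanish.\<close>
  then have "0 < G k l * y l" using pos nonneg k by (simp add: less_le)
  also have "\<dots> \<le> (\<Sum>j\<in>I. G k j * y j)"
    using fin l k nonneg less_imp_le[OF pos[OF k]]
    by (intro member_le_sum[where f = "\<lambda>j. G k j * y j"]) (auto intro!: mult_nonneg_nonneg)
  also have "\<dots> = M * y k"
    by (rule quad_max_eigen[OF fin sym max eq k])
  finally show ?thesis using nonneg[OF k] by (cases "y k = 0") auto
qed

section \<open>Orthogonality, norms and derivatives\<close>

definition geg_h :: "real \<Rightarrow> nat \<Rightarrow> real" where
  "geg_h lam k = geg_int lam (geg lam k * geg lam k)"

text \<open>By Parseval, the squared norm of the derivative of D_j.\<close>

definition geg_T :: "real \<Rightarrow> nat \<Rightarrow> real" where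
  "geg_T lam j = (\<Sum>k\<in>{k. k < j \<and> odd (j - k)}. (geg_c lam k)\<^sup>2 * geg_h lam k)"

text \<open>For i + j even this is a quarter of the inner product of the derivatives of the
  normalized D_i and D_j; the quarter accounts for the factor 2 in front of the square roots in the
  theorem. The formula ignores parity, so it can be shifted freely.\<close>

definition geg_G :: "real \<Rightarrow> nat \<Rightarrow> nat \<Rightarrow> real" where
  "geg_G lam i j = geg_T lam (min i j) / (4 * sqrt (geg_h lam i) * sqrt (geg_h lam j))"

text \<open>Integration by parts applied to g times the derivative of f. The right-hand side is
  symmetric in f and g, so the differential operator is self-adjoint.\<close>

lemma geg_int_sturm_liouville:
  assumes "lam > - 1/2"
  shows "geg_int lam (g * ([:1, 0, -1:] * pderiv (pderiv f) - [:0, 2 * lam + 1:] * pderiv f))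
     = - geg_int lam ([:1, 0, -1:] * (pderiv g * pderiv f))"
proof -
  have "[:1, 0, -1:] * pderiv (g * pderiv f) - [:0, 2 * lam + 1:] * (g * pderiv f)
     = g * ([:1, 0, -1:] * pderiv (pderiv f) - [:0, 2 * lam + 1:] * pderiv f) + [:1, 0, -1:] * (pderiv g * pderiv f)"
    by (simp only: pderiv_mult ring_distribs mult_ac add_ac diff_conv_add_uminus)
  then show ?thesis
    using geg_int_by_parts[OF assms, of "g * pderiv f"] by (simp only: geg_int_add[OF assms])
qed

lemma geg_orthogonal:
  assumes lam: "lam > - 1/2" and "i \<noteq> j"
  shows "geg_int lam (geg lam i * geg lam j) = 0"
proof -
  let ?L = "\<lambda>k. real k * (real k + 2 * lam)"
  have *: "?L b * geg_int lam (geg lam a * geg lam b)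
      = geg_int lam ([:1, 0, -1:] * (pderiv (geg lam a) * pderiv (geg lam b)))" for a b
    using geg_int_sturm_liouville[OF lam, of "geg lam a" "geg lam b"]
    unfolding geg_ode mult_smult_right geg_int_smult by simp
  have "?L i * geg_int lam (geg lam i * geg lam j) = ?L j * geg_int lam (geg lam i * geg lam j)"
    using *[of j i] *[of i j] by (simp only: mult.commute[of "geg lam j"] mult.commute[of "pderiv (geg lam j)"])
  moreover have "?L i \<noteq> ?L j"
  proof
    assume "?L i = ?L j"
    \<comment> \<open>The second factor is positive since i + j is at least 1 and 2 * lam > -1: the
      eigenvalues are distinct.\<close>
    then have "(real i - real j) * (real i + real j + 2 * lam) = 0" by (simp add: algebra_simps)
    moreover have "real i + real j \<ge> 1" using \<open>i \<noteq> j\<close> by linarith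
    ultimately show False using lam \<open>i \<noteq> j\<close> by auto
  qed
  ultimately show ?thesis by simp
qed

text \<open>Testing the three-term recurrence against D_(k+2) and against D_k expresses the inner
  product \<open>?J\<close> of x D_k and D_(k+1) through the norm of either neighbour; eliminating
  it leaves a two-term recurrence for the norms.\<close>

lemma geg_h_recurrence:
  assumes lam: "lam > - 1/2"
  shows "(1 + lam) * geg_h lam 1 = 2 * geg_h lam 0"
    "geg_h lam (Suc (Suc k)) * ((real k + 2) * (real k + 2 + lam))
      = geg_h lam (Suc k) * ((real k + 1 + 2 * lam) * (real k + 1 + lam))"
proof -
  let ?J = "\<lambda>k. geg_int lam ([:0, 1:] * geg lam k * geg lam (Suc k))"
  have r: "Polynomial.smult (real k + 2) (geg lam (Suc (Suc k)))
    = Polynomial.smult (2 * (real k + 1 + lam)) ([:0, 1:] * geg lam (Suc k)) - Polynomial.smult (geg_gamma lam k) (geg lam k)" for k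
    by (rule poly_ext) (use geg_recurrence[of k lam] in \<open>simp del: geg.simps add: mult.assoc\<close>)
  have rint: "(real k + 2) * geg_int lam (geg lam (Suc (Suc k)) * f)
      = 2 * (real k + 1 + lam) * geg_int lam ([:0, 1:] * geg lam (Suc k) * f) - geg_gamma lam k * geg_int lam (geg lam k * f)" for k f
    using arg_cong[OF r[of k], of "\<lambda>p. geg_int lam (p * f)"]
    unfolding left_diff_distrib mult_smult_left geg_int_diff[OF lam] geg_int_smult by simp
  have 1: "(real k + 2) * geg_h lam (Suc (Suc k)) = 2 * (real k + 1 + lam) * ?J (Suc k)" for k
    using rint[of k "geg lam (Suc (Suc k))"] geg_orthogonal[OF lam, of k "Suc (Suc k)"]
    by (simp del: geg.simps add: geg_h_def)
  have 2: "2 * (real k + 1 + lam) * ?J k = geg_gamma lam k * geg_h lam k" for k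
    using rint[of k "geg lam k"] geg_orthogonal[OF lam, of "Suc (Suc k)" k]
    by (simp del: geg.simps add: geg_h_def mult.assoc mult.commute[of "geg lam (Suc k)"])
  have "geg lam 1 * geg lam 1 = Polynomial.smult 2 ([:0, 1:] * geg lam 0 * geg lam (Suc 0))" by simp
  then have "geg_h lam 1 = 2 * ?J 0" unfolding geg_h_def by (simp only: geg_int_smult)
  then show "(1 + lam) * geg_h lam 1 = 2 * geg_h lam 0"
    using 2[of 0] by (simp add: geg_gamma_def distrib_right)
  have "((real k + 2) * geg_h lam (Suc (Suc k))) * (real k + 2 + lam) = (real k + 1 + lam) * (2 * (real (Suc k) + 1 + lam) * ?J (Suc k))"
    unfolding 1 by (simp add: algebra_simps)
  also have "\<dots> = (real k + 1 + lam) * ((real k + 1 + 2 * lam) * geg_h lam (Suc k))"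
    unfolding 2 by (simp add: geg_gamma_def algebra_simps)
  finally show "geg_h lam (Suc (Suc k)) * ((real k + 2) * (real k + 2 + lam))
      = geg_h lam (Suc k) * ((real k + 1 + 2 * lam) * (real k + 1 + lam))"
    by (simp only: mult_ac)
qed

text \<open>Positivity spreads from the mass of the weight through the recurrence, whose factors are
  positive for \<open>lam > -1/2\<close>.\<close>

lemma geg_h_pos:
  assumes lam: "lam > - 1/2"
  shows "geg_h lam k > 0"
proof (induction k rule: less_induct)
  case (less k)
  consider "k = 0" | "k = 1" | j where "k = Suc (Suc j)"
    by (metis One_nat_def not0_implies_Suc)
  then show ?case
  proof cases
    case 1
    then show ?thesis using geg_int_one_pos[OF lam] by (simp add: geg_h_def)
  next
    case 2
    have "(1 + lam) * geg_h lam 1 > 0"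
      using geg_h_recurrence(1)[OF lam] less.IH[of 0] 2 by simp
    then show ?thesis using lam 2 by (simp add: zero_less_mult_iff)
  next
    case 3
    have "geg_h lam (Suc j) * ((real j + 1 + 2 * lam) * (real j + 1 + lam)) > 0"
      using less.IH[of "Suc j"] 3 lam by (intro mult_pos_pos) auto
    then have "geg_h lam k * ((real j + 2) * (real j + 2 + lam)) > 0"
      unfolding geg_h_recurrence(2)[OF lam, symmetric] 3 .
    moreover have "(real j + 2) * (real j + 2 + lam) > 0"
      using lam by (intro mult_pos_pos) auto
    ultimately show ?thesis by (rule zero_less_mult_pos2)
  qed
qed

lemma geg_T_Suc_Suc: "geg_T lam (Suc (Suc j)) = geg_T lam j + (geg_c lam (Suc j))\<^sup>2 * geg_h lam (Suc j)"
proof -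
  have "{k. k < Suc (Suc j) \<and> odd (Suc (Suc j) - k)} = insert (Suc j) {k. k < j \<and> odd (j - k)}"
    by (auto simp: less_Suc_eq Suc_diff_le)
  then show ?thesis by (simp add: geg_T_def add.commute)
qed

text \<open>Induction in steps of two. Writing the norms of D_i and D_(i+2) as multiples of that of
  D_(i+1) reduces the step to a polynomial identity in i and lam.\<close>

lemma geg_T_closed_form:
  assumes lam: "lam > - 1/2"
  shows "(2 * lam + 1) * geg_T lam j = 2 * real j * (real j + lam) * (real j + 2 * lam) * geg_h lam j"
proof (induction j rule: less_induct)
  case (less j)
  consider "j = 0" | "j = 1" | i where "j = Suc (Suc i)"
    by (metis One_nat_def not0_implies_Suc)
  then show ?case
  proof cases
    case 1
    then show ?thesis by (simp add: geg_T_def)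
  next
    case 2
    then have "{k. k < j \<and> odd (j - k)} = {0}" by auto
    then have "geg_T lam j = 4 * geg_h lam 0" using 2 by (simp add: geg_T_def geg_c_def)
    moreover have "(2 * lam + 1) * (4 * geg_h lam 0) = (2 * lam + 1) * 2 * ((1 + lam) * geg_h lam 1)"
      unfolding geg_h_recurrence(1)[OF lam] by simp
    ultimately show ?thesis using 2 by (simp add: algebra_simps)
  next
    case 3
    let ?h = "geg_h lam (Suc i)"
    have low: "(2 * lam + 1) * geg_T lam i = 2 * real i * (real i + 1) * (real i + 1 + lam) * ?h"
    proof (cases i)
      case 0
      then show ?thesis by (simp add: geg_T_def)
    next
      case (Suc m)
      have "(2 * lam + 1) * geg_T lam i = 2 * real i * (geg_h lam i * ((real i + 2 * lam) * (real i + lam)))"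
        using less.IH[of i] 3 by (simp add: algebra_simps)
      also have "geg_h lam i * ((real i + 2 * lam) * (real i + lam)) = ?h * ((real i + 1) * (real i + 1 + lam))"
        using geg_h_recurrence(2)[OF lam, of m] Suc by (simp add: add_ac)
      finally show ?thesis by (simp add: algebra_simps)
    qed
    have "2 * real j * (real j + lam) * (real j + 2 * lam) * geg_h lam j
        = 2 * (real i + 2 + 2 * lam) * (geg_h lam (Suc (Suc i)) * ((real i + 2) * (real i + 2 + lam)))"
      using 3 by (simp add: algebra_simps)
    also have "\<dots> = 2 * (real i + 2 + 2 * lam) * (?h * ((real i + 1 + 2 * lam) * (real i + 1 + lam)))"
      unfolding geg_h_recurrence(2)[OF lam] ..
    also have "\<dots> = (2 * lam + 1) * geg_T lam i + (2 * lam + 1) * ((2 * (real i + 1 + lam))\<^sup>2 * ?h)"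
      unfolding low by (simp add: algebra_simps power2_eq_square)
    also have "\<dots> = (2 * lam + 1) * geg_T lam j"
      unfolding 3 geg_T_Suc_Suc geg_c_def by (simp add: algebra_simps)
    finally show ?thesis by simp
  qed
qed

lemma geg_T_pos:
  assumes lam: "lam > - 1/2" and "j > 0"
  shows "geg_T lam j > 0"
proof -
  have "(2 * lam + 1) * geg_T lam j > 0"
    unfolding geg_T_closed_form[OF lam] using assms geg_h_pos[OF lam] by (intro mult_pos_pos) auto
  then show ?thesis using lam by (simp add: zero_less_mult_iff)
qed

section \<open>Positivity and growth of the entries under a diagonal shift\<close>

lemma geg_G_sym: "geg_G lam i j = geg_G lam j i"
  by (simp add: geg_G_def min.commute mult_ac)

lemma geg_G_pos:
  assumes "lam > - 1/2" "i > 0" "j > 0"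
  shows "geg_G lam i j > 0"
  using assms by (simp add: geg_G_def geg_T_pos geg_h_pos)

lemma geg_G_zero [simp]: "geg_G lam 0 j = 0" "geg_G lam i 0 = 0"
  by (simp_all add: geg_G_def geg_T_def)

text \<open>
  This shift inequality makes the parity class of the degree \<open>n\<close> dominate the opposite one. It fails
  for the squared entries of the triangular factors when \<open>\<lambda> < 0\<close>; passing to their column sums
  \<open>geg_T\<close>, which have a closed form, is what makes it true for every \<open>\<lambda> > -1/2\<close>. Below, \<open>\<rho>\<close> is the
  ratio of consecutive squared norms of \<open>D\<^sub>k\<close> and \<open>\<tau>\<close> the ratio of the squared norms of \<open>D'\<^sub>k\<close> and \<open>D\<^sub>k\<close>.
\<close>

lemma geg_G_less_Suc:
  assumes lam: "lam > - 1/2"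
  shows "geg_G lam i j < geg_G lam (Suc i) (Suc j)"
proof (induction i j rule: linorder_wlog)
  case (sym i j)
  then show ?case by (simp add: geg_G_sym)
next
  case (le i j)
  show ?case
  proof (cases "i = 0")
    case True
    then show ?thesis using geg_G_pos[OF lam] by simp
  next
    case False
    note h = geg_h_pos[OF lam]
    define \<rho> where "\<rho> = (\<lambda>k. (real k + 2 * lam) * (real k + lam) / ((real k + 1) * (real k + 1 + lam)))"
    define \<tau> where "\<tau> = (\<lambda>k. 2 * real k * (real k + lam) * (real k + 2 * lam) / (2 * lam + 1))"
    have \<rho>_pos: "\<rho> k > 0" if "k \<ge> 1" for k
      using lam that unfolding \<rho>_def by (intro divide_pos_pos mult_pos_pos) auto
    have \<tau>_pos: "\<tau> k > 0" if "k \<ge> 1" for k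
      using lam that unfolding \<tau>_def by (intro divide_pos_pos mult_pos_pos) auto
    have hS: "geg_h lam (Suc k) = \<rho> k * geg_h lam k" if k: "k \<ge> 1" for k
    proof -
      obtain m where m: "k = Suc m" using k by (cases k) auto
      have "(real k + 1) * (real k + 1 + lam) > 0" using lam by (intro mult_pos_pos) auto
      then show ?thesis
        using geg_h_recurrence(2)[OF lam, of m] unfolding m \<rho>_def by (simp add: field_simps)
    qed
    have T: "geg_T lam k = \<tau> k * geg_h lam k" for k
      using geg_T_closed_form[OF lam, of k] lam unfolding \<tau>_def by (simp add: field_simps)
    have i: "i \<ge> 1" and j: "j \<ge> 1" using False le by auto
    \<comment> \<open>After squaring, the claim is the inequality \<open>key\<close> below.
      Absorbing one factor \<tau> (i + 1) into \<rho> i by this identity leaves two separate facts: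
      \<tau> i < \<tau> (i + 1), and \<rho> j is at most (i + 1 + 2 lam) / i.\<close>
    have step: "\<tau> (Suc i) * \<rho> i = \<tau> i * ((real i + 1 + 2 * lam) / real i)"
    proof -
      have "real i + 1 + lam > 0" using lam by simp
      then show ?thesis using lam i unfolding \<tau>_def \<rho>_def by (simp add: divide_simps) (simp add: algebra_simps)
    qed
    have "2 * real i * (real i + lam) < 2 * real (Suc i) * (real (Suc i) + lam)"
      using lam i by (rule_tac mult_strict_mono) auto
    then have "2 * real i * (real i + lam) * (real i + 2 * lam) < 2 * real (Suc i) * (real (Suc i) + lam) * (real (Suc i) + 2 * lam)"
      using lam i by (rule_tac mult_strict_mono) auto
    then have "\<tau> i < \<tau> (Suc i)"
      unfolding \<tau>_def using lam by (intro divide_strict_right_mono) auto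
    have "\<rho> j \<le> (real i + 1 + 2 * lam) / real i"
    proof -
      have "real i * (real j + 2 * lam) \<le> (real i + 1 + 2 * lam) * (real j + 1)"
      \<comment> \<open>The difference of the two sides is i (1 - 2 lam) + (1 + 2 lam) (j + 1). Both
        terms are nonnegative for lam up to 1/2; beyond that i \<le> j is needed.\<close>
      proof (cases "lam \<le> 1/2")
        case True
        then have "0 \<le> real i * (1 - 2 * lam) + (1 + 2 * lam) * (real j + 1)"
          using lam by (rule_tac add_nonneg_nonneg; rule_tac mult_nonneg_nonneg) auto
        then show ?thesis by (simp add: algebra_simps)
      next
        case False
        then have "2 * lam * real i \<le> 2 * lam * (real j + 1)" using le by (intro mult_left_mono) auto
        then show ?thesis by (simp add: algebra_simps)
      qed
      then have "real i * (real j + 2 * lam) * (real j + lam) \<le> (real i + 1 + 2 * lam) * (real j + 1) * (real j + 1 + lam)"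
        using lam j by (rule_tac mult_mono) (auto intro!: mult_nonneg_nonneg)
      moreover have "(real j + 1) * (real j + 1 + lam) > 0" using lam by (intro mult_pos_pos) auto
      ultimately show ?thesis unfolding \<rho>_def using i by (simp add: divide_le_eq pos_le_divide_eq mult_ac)
    qed
    then have "(\<tau> i)\<^sup>2 * \<rho> j \<le> \<tau> i * (\<tau> (Suc i) * \<rho> i)"
      unfolding step power2_eq_square mult.assoc using \<tau>_pos[OF i] by (intro mult_left_mono) auto
    also have "\<dots> < \<tau> (Suc i) * (\<tau> (Suc i) * \<rho> i)"
      using \<open>\<tau> i < \<tau> (Suc i)\<close> \<tau>_pos[of "Suc i"] \<rho>_pos[OF i] by (intro mult_strict_right_mono mult_pos_pos) auto
    finally have key: "(\<tau> i)\<^sup>2 * \<rho> j < (\<tau> (Suc i))\<^sup>2 * \<rho> i" by (simp add: power2_eq_square mult_ac)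
    have G: "geg_G lam a b = \<tau> a * sqrt (geg_h lam a / geg_h lam b) / 4" if "a \<le> b" for a b
      using that h[of a] h[of b] unfolding geg_G_def T
      by (simp add: real_sqrt_divide min_absorb1 field_simps)
    have "(\<tau> i)\<^sup>2 * (geg_h lam i / geg_h lam j) < (\<tau> (Suc i))\<^sup>2 * (geg_h lam (Suc i) / geg_h lam (Suc j))"
      unfolding hS[OF i] hS[OF j] using key h[of i] h[of j] \<rho>_pos[OF j] by (simp add: field_simps)
    then have "(\<tau> i * sqrt (geg_h lam i / geg_h lam j))\<^sup>2 < (\<tau> (Suc i) * sqrt (geg_h lam (Suc i) / geg_h lam (Suc j)))\<^sup>2"
      using h by (simp add: power_mult_distrib less_imp_le)
    then have "\<tau> i * sqrt (geg_h lam i / geg_h lam j) < \<tau> (Suc i) * sqrt (geg_h lam (Suc i) / geg_h lam (Suc j))"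
      using \<tau>_pos[of "Suc i"] h by (intro power2_less_imp_less[where y = "\<tau> (Suc i) * sqrt _"]) (auto simp: less_imp_le)
    then show ?thesis using le by (simp add: G)
  qed
qed

text \<open>The degrees occurring in the two derivatives are nested if i + j is even and disjoint
  otherwise; orthogonality keeps the common ones.\<close>

lemma geg_int_pderiv:
  assumes lam: "lam > - 1/2"
  shows "geg_int lam (pderiv (geg lam i) * pderiv (geg lam j))
     = (if even (i + j) then 4 * geg_G lam i j * sqrt (geg_h lam i) * sqrt (geg_h lam j) else 0)"
proof -
  let ?S = "\<lambda>j :: nat. {k. k < j \<and> odd (j - k)}"
  have fin: "finite (?S j)" for j by (rule finite_subset[of _ "{..<j}"]) auto
  have "geg_int lam (pderiv (geg lam i) * pderiv (geg lam j))
      = (\<Sum>k\<in>?S i. \<Sum>l\<in>?S j. geg_c lam l * (geg_c lam k * geg_int lam (geg lam k * geg lam l)))"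
    unfolding pderiv_geg sum_product geg_int_sum[OF lam] mult_smult_left mult_smult_right geg_int_smult ..
  also have "\<dots> = (\<Sum>k\<in>?S i. \<Sum>l\<in>?S j. if k = l then (geg_c lam k)\<^sup>2 * geg_h lam k else 0)"
    by (intro sum.cong refl) (auto simp: geg_orthogonal[OF lam] geg_h_def power2_eq_square)
  also have "\<dots> = (\<Sum>k\<in>?S i. if k \<in> ?S j then (geg_c lam k)\<^sup>2 * geg_h lam k else 0)"
    by (simp only: sum.delta'[OF fin])
  also have "\<dots> = (\<Sum>k\<in>?S i \<inter> ?S j. (geg_c lam k)\<^sup>2 * geg_h lam k)"
    by (rule sum.inter_restrict[OF fin, symmetric])
  also have "?S i \<inter> ?S j = (if even (i + j) then ?S (min i j) else {})"
    by (auto simp: even_diff_nat min_def)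
  also have "(\<Sum>k\<in>\<dots>. (geg_c lam k)\<^sup>2 * geg_h lam k) = (if even (i + j) then geg_T lam (min i j) else 0)"
    by (simp add: geg_T_def)
  also have "geg_T lam (min i j) = 4 * geg_G lam i j * sqrt (geg_h lam i) * sqrt (geg_h lam j)"
    using geg_h_pos[OF lam, of i] geg_h_pos[OF lam, of j] by (simp add: geg_G_def)
  finally show ?thesis .
qed

section \<open>The matrices as Gram matrices\<close>

text \<open>The constant \<open>\<kappa>\<close> in \<open>\<parallel>D\<^sub>k\<parallel>\<^sup>2 = \<kappa> \<Gamma>(k + 2\<lambda>) / (k! (k + \<lambda>))\<close>; it cancels in the matrices.\<close>

definition geg_kappa :: "real \<Rightarrow> real" where
  "geg_kappa lam = 2 * geg_h lam 0 / Gamma (2 * lam + 1)"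

text \<open>For \<open>lam > -1/2\<close>, \<open>geg_a lam k * geg_b lam j\<close> is half the
  coefficient of the normalized D_k in the derivative of the normalized D_j, whenever D_k occurs
  there.\<close>

definition geg_a :: "real \<Rightarrow> nat \<Rightarrow> real" where
  "geg_a lam j = sqrt ((geg_c lam j)\<^sup>2 * geg_h lam j / (4 * geg_kappa lam))"

definition geg_b :: "real \<Rightarrow> nat \<Rightarrow> real" where
  "geg_b lam j = sqrt (geg_kappa lam / geg_h lam j)"

lemma geg_kappa_pos: "lam > - 1/2 \<Longrightarrow> geg_kappa lam > 0"
  by (simp add: geg_kappa_def geg_h_pos Gamma_real_pos)

text \<open>This solves the norm recurrence; \<open>geg_kappa\<close> is fixed by degree 1. Degree 0
  is left out because D_0 is not divided by lam.\<close>

lemma geg_h_Gamma: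
  assumes lam: "lam > - 1/2"
  shows "geg_h lam (Suc k) * (fact (Suc k) * (real (Suc k) + lam)) = geg_kappa lam * Gamma (real (Suc k) + 2 * lam)"
proof (induction k)
  case 0
  have "Gamma (2 * lam + 1) > 0" using lam by (intro Gamma_real_pos) simp
  then show ?case using geg_h_recurrence(1)[OF lam] by (simp add: geg_kappa_def add.commute mult.commute)
next
  case (Suc k)
  have "real (Suc k) + 2 * lam \<notin> \<int>\<^sub>\<le>\<^sub>0" using lam by (auto elim!: nonpos_Ints_cases)
  then have *: "Gamma (real (Suc (Suc k)) + 2 * lam) = (real k + 1 + 2 * lam) * Gamma (real (Suc k) + 2 * lam)"
    using Gamma_plus1[of "real (Suc k) + 2 * lam"] by (simp add: add_ac)
  have "geg_h lam (Suc (Suc k)) * (fact (Suc (Suc k)) * (real (Suc (Suc k)) + lam))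
      = fact (Suc k) * (geg_h lam (Suc (Suc k)) * ((real k + 2) * (real k + 2 + lam)))"
    by (simp add: algebra_simps)
  also have "\<dots> = (real k + 1 + 2 * lam) * (geg_h lam (Suc k) * (fact (Suc k) * (real (Suc k) + lam)))"
    unfolding geg_h_recurrence(2)[OF lam] by (simp add: algebra_simps)
  also have "\<dots> = geg_kappa lam * Gamma (real (Suc (Suc k)) + 2 * lam)"
    unfolding Suc.IH * by simp
  finally show ?case .
qed

lemma geg_a_Suc:
  assumes lam: "lam > - 1/2"
  shows "geg_a lam (Suc k) = sqrt (Gamma (real (Suc k) + 2 * lam) * (real (Suc k) + lam) / Gamma (real (Suc k) + 1))"
proof -
  have k: "real (Suc k) + lam > 0" using lam by simp
  have "(geg_c lam (Suc k))\<^sup>2 * geg_h lam (Suc k) / (4 * geg_kappa lam)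
      = (real (Suc k) + lam) * (geg_h lam (Suc k) * (fact (Suc k) * (real (Suc k) + lam))) / (geg_kappa lam * fact (Suc k))"
    using geg_kappa_pos[OF lam] by (simp add: geg_c_def field_simps power2_eq_square del: fact_Suc)
  also have "\<dots> = Gamma (real (Suc k) + 2 * lam) * (real (Suc k) + lam) / fact (Suc k)"
    unfolding geg_h_Gamma[OF lam] using geg_kappa_pos[OF lam] by (simp del: fact_Suc of_nat_Suc)
  finally show ?thesis
    unfolding geg_a_def using Gamma_fact[of "Suc k", where 'a = real] by (simp add: add.commute del: fact_Suc of_nat_Suc)
qed

text \<open>The norm of D_0 gives Gamma (2 lam + 1) / 2, regular at 0; this explains the limiting
  value in \<open>alpha_tilde\<close>.\<close>

lemma geg_a_zero:
  assumes lam: "lam > - 1/2"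
  shows "geg_a lam 0 = sqrt (if lam = 0 then 1/2 else Gamma (2 * lam) * lam)"
proof -
  have h: "geg_h lam 0 > 0" by (rule geg_h_pos[OF lam])
  have "(geg_c lam 0)\<^sup>2 * geg_h lam 0 / (4 * geg_kappa lam) = Gamma (2 * lam + 1) / 2"
    using h by (simp add: geg_c_def geg_kappa_def)
  also have "\<dots> = (if lam = 0 then 1/2 else Gamma (2 * lam) * lam)"
  proof (cases "lam = 0")
    case False
    have "2 * lam \<notin> \<int>\<^sub>\<le>\<^sub>0"
    proof
      assume "2 * lam \<in> \<int>\<^sub>\<le>\<^sub>0"
      then obtain z :: int where "2 * lam = of_int z" "z \<le> 0" by (elim nonpos_Ints_cases)
      then show False using lam False by (cases "z = 0") auto
    qed
    then show ?thesis using False by (simp add: Gamma_plus1)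
  qed simp
  finally show ?thesis by (simp add: geg_a_def)
qed

lemma geg_b_Suc:
  assumes lam: "lam > - 1/2"
  shows "geg_b lam (Suc k) = sqrt (Gamma (real (Suc k) + 1) * (real (Suc k) + lam) / Gamma (real (Suc k) + 2 * lam))"
proof -
  have "Gamma (real (Suc k) + 2 * lam) > 0" using lam by (intro Gamma_real_pos) simp
  then have "geg_kappa lam / geg_h lam (Suc k) = fact (Suc k) * (real (Suc k) + lam) / Gamma (real (Suc k) + 2 * lam)"
    using geg_h_Gamma[OF lam, of k] geg_h_pos[OF lam, of "Suc k"]
    by (simp add: frac_eq_eq mult_ac del: fact_Suc of_nat_Suc)
  then show ?thesis
    unfolding geg_b_def using Gamma_fact[of "Suc k", where 'a = real] by (simp add: add.commute del: fact_Suc of_nat_Suc)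
qed

text \<open>Rows correspond to degrees of the derivative and columns to degrees of the polynomial.
  The unsimplified \<open>+ 0\<close> matches the parity offset \<open>e\<close> of
  \<open>geg_gram_mat\<close>.\<close>

lemma alpha_beta_eq:
  assumes lam: "lam > - 1/2"
  shows "alpha lam (i + 1) = geg_a lam (2 * i + 1)" "beta lam (i + 1) = geg_b lam (Suc (2 * i + 1))"
    "alpha_tilde lam (i + 1) = geg_a lam (2 * i + 0)" "beta_tilde lam (i + 1) = geg_b lam (Suc (2 * i + 0))"
proof -
  show "alpha lam (i + 1) = geg_a lam (2 * i + 1)"
    using geg_a_Suc[OF lam, of "2 * i"] by (simp add: alpha_def algebra_simps)
  show "beta lam (i + 1) = geg_b lam (Suc (2 * i + 1))"
    using geg_b_Suc[OF lam, of "2 * i + 1"] by (simp add: beta_def algebra_simps)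
  show "beta_tilde lam (i + 1) = geg_b lam (Suc (2 * i + 0))"
    using geg_b_Suc[OF lam, of "2 * i"] by (simp add: beta_tilde_def algebra_simps)
  show "alpha_tilde lam (i + 1) = geg_a lam (2 * i + 0)"
  proof (cases i)
    case 0
    then show ?thesis by (simp add: alpha_tilde_def geg_a_zero[OF lam])
  next
    case (Suc m)
    then show ?thesis
      using geg_a_Suc[OF lam, of "2 * m + 1"] by (simp add: alpha_tilde_def algebra_simps)
  qed
qed

lemma geg_T_sum:
  assumes "e \<le> 1"
  shows "geg_T lam (Suc (2 * i + e)) = (\<Sum>k\<le>i. (geg_c lam (2 * k + e))\<^sup>2 * geg_h lam (2 * k + e))"
proof (induction i)
  case 0
  have "{k. k < Suc e \<and> odd (Suc e - k)} = {e}" using assms by (cases e) (auto simp: less_Suc_eq)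
  then show ?case by (simp add: geg_T_def)
next
  case (Suc i)
  then show ?case using geg_T_Suc_Suc[of lam "Suc (2 * i + e)"] by simp
qed

text \<open>The columns of C hold half the coordinates of the derivatives of normalized D_j, so this
  is a Gram matrix. The offset e = 1 serves even degrees and e = 0 odd ones.\<close>

lemma geg_gram_mat:
  assumes lam: "lam > - 1/2" and e: "e \<le> 1"
    and C: "C = Matrix.mat m m (\<lambda>(i, j). if i \<le> j then geg_a lam (2 * i + e) * geg_b lam (Suc (2 * j + e)) else 0)"
  shows "transpose_mat C * C = Matrix.mat m m (\<lambda>(i, j). geg_G lam (Suc (2 * i + e)) (Suc (2 * j + e)))"
proof (rule eq_matI)
  fix i j
  assume "i < dim_row (Matrix.mat m m (\<lambda>(i, j). geg_G lam (Suc (2 * i + e)) (Suc (2 * j + e))))"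
    and "j < dim_col (Matrix.mat m m (\<lambda>(i, j). geg_G lam (Suc (2 * i + e)) (Suc (2 * j + e))))"
  then have ij: "i < m" "j < m" by auto
  let ?d = "\<lambda>i. Suc (2 * i + e)"
  note \<kappa> = geg_kappa_pos[OF lam] and h = geg_h_pos[OF lam]
  have "(transpose_mat C * C) $$ (i, j) = (\<Sum>k<m. C $$ (k, i) * C $$ (k, j))"
    using ij by (simp add: C scalar_prod_def lessThan_atLeast0)
  also have "\<dots> = (\<Sum>k<m. if k \<in> {..min i j} then (geg_a lam (2 * k + e))\<^sup>2 * (geg_b lam (?d i) * geg_b lam (?d j)) else 0)"
    using ij by (intro sum.cong) (auto simp: C power2_eq_square)
  also have "\<dots> = (\<Sum>k\<in>{..<m} \<inter> {..min i j}. (geg_a lam (2 * k + e))\<^sup>2 * (geg_b lam (?d i) * geg_b lam (?d j)))"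
    by (simp only: sum.inter_restrict finite_lessThan)
  also have "{..<m} \<inter> {..min i j} = {..min i j}" using ij by auto
  also have "(\<Sum>k\<in>{..min i j}. (geg_a lam (2 * k + e))\<^sup>2 * (geg_b lam (?d i) * geg_b lam (?d j)))
      = geg_T lam (?d (min i j)) / (4 * geg_kappa lam) * (geg_b lam (?d i) * geg_b lam (?d j))"
  proof -
    have "(geg_a lam k)\<^sup>2 = (geg_c lam k)\<^sup>2 * geg_h lam k / (4 * geg_kappa lam)" for k
      unfolding geg_a_def using \<kappa> h[of k] by (intro real_sqrt_pow2) (auto intro!: divide_nonneg_nonneg mult_nonneg_nonneg)
    then show ?thesis
      unfolding geg_T_sum[OF e] by (simp add: sum_distrib_right sum_divide_distrib)
  qed
  also have "\<dots> = geg_G lam (?d i) (?d j)"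
    using \<kappa> by (simp add: geg_G_def geg_b_def real_sqrt_divide min_def)
  finally show "(transpose_mat C * C) $$ (i, j)
      = Matrix.mat m m (\<lambda>(i, j). geg_G lam (Suc (2 * i + e)) (Suc (2 * j + e))) $$ (i, j)"
    using ij by simp
qed (simp_all add: C)

lemma A_mat_eq:
  assumes lam: "lam > - 1/2"
  shows "A_mat lam m = Matrix.mat m m (\<lambda>(i, j). geg_G lam (Suc (2 * i + 1)) (Suc (2 * j + 1)))"
  unfolding A_mat_def by (rule geg_gram_mat[OF lam]) (simp_all only: C_mat_def alpha_beta_eq[OF lam] order_refl)

lemma A_tilde_mat_eq:
  assumes lam: "lam > - 1/2"
  shows "A_tilde_mat lam m = Matrix.mat m m (\<lambda>(i, j). geg_G lam (Suc (2 * i + 0)) (Suc (2 * j + 0)))"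
  unfolding A_tilde_mat_def by (rule geg_gram_mat[OF lam]) (simp_all only: C_tilde_mat_def alpha_beta_eq[OF lam] le0)

section \<open>Expansion of complex polynomials\<close>

lemma degree_coeff_geg:
  assumes "lam > - 1/2"
  shows "degree (geg lam k) \<le> k \<and> coeff (geg lam k) k > 0"
  using assms
proof (induction lam k rule: geg.induct)
  case (3 lam k)
  have d: "degree (geg lam k) \<le> k" "degree (geg lam (Suc k)) \<le> Suc k" and c: "coeff (geg lam (Suc k)) (Suc k) > 0"
    using 3 by auto
  have "degree (geg lam (Suc (Suc k))) \<le> Suc (Suc k)"
    unfolding geg.simps
    by (intro order.trans[OF degree_smult_le] degree_diff_le order.trans[OF degree_mult_le])
       (use d in \<open>auto intro: order.trans[OF degree_smult_le]\<close>)
  moreover have "coeff (geg lam k) (Suc (Suc k)) = 0" "coeff (geg lam (Suc k)) (Suc (Suc k)) = 0"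
    using d by (auto intro!: coeff_eq_0)
  then have "coeff (geg lam (Suc (Suc k))) (Suc (Suc k)) = 2 * (real k + 1 + lam) * coeff (geg lam (Suc k)) (Suc k) / real (k + 2)"
    by (simp add: field_simps)
  moreover have "\<dots> > 0" using c 3 by (intro divide_pos_pos mult_pos_pos) auto
  ultimately show ?case by simp
qed simp_all

abbreviation cpoly :: "real poly \<Rightarrow> complex poly" where
  "cpoly \<equiv> map_poly complex_of_real"

definition geg_poly :: "real \<Rightarrow> nat \<Rightarrow> (nat \<Rightarrow> complex) \<Rightarrow> complex poly" where
  "geg_poly lam n x = (\<Sum>j\<le>n. Polynomial.smult (x j / complex_of_real (sqrt (geg_h lam j))) (cpoly (geg lam j)))"

lemma coeff_cpoly: "coeff (cpoly p) k = complex_of_real (coeff p k)"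
  by (simp add: coeff_map_poly)

lemma poly_cpoly: "poly (cpoly p) (complex_of_real t) = complex_of_real (poly p t)"
  by (induction p) (simp_all add: map_poly_pCons)

lemma pderiv_cpoly: "pderiv (cpoly p) = cpoly (pderiv p)"
  by (rule poly_eqI) (simp add: coeff_pderiv coeff_cpoly)

lemma degree_geg_poly:
  assumes "lam > - 1/2"
  shows "degree (geg_poly lam n x) \<le> n"
  unfolding geg_poly_def
proof (rule degree_sum_le)
  fix j assume "j \<in> {..n}"
  then show "degree (Polynomial.smult (x j / complex_of_real (sqrt (geg_h lam j))) (cpoly (geg lam j))) \<le> n"
    using degree_coeff_geg[OF assms, of j] degree_map_poly_le[of complex_of_real "geg lam j"]
      degree_smult_le[of "x j / complex_of_real (sqrt (geg_h lam j))" "cpoly (geg lam j)"] by simp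
qed simp

lemma geg_poly_exists:
  assumes lam: "lam > - 1/2" and "degree p \<le> n"
  shows "\<exists>x. p = geg_poly lam n x"
  using assms(2)
proof (induction n arbitrary: p)
  case 0
  then obtain a where p: "p = [:a:]" by (auto dest: degree_eq_zeroE)
  have "geg_h lam 0 > 0" by (rule geg_h_pos[OF lam])
  then have "p = geg_poly lam 0 (\<lambda>_. a * complex_of_real (sqrt (geg_h lam 0)))"
    by (simp add: geg_poly_def p)
  then show ?case by blast
next
  case (Suc n)
  let ?g = "cpoly (geg lam (Suc n))"
  define c where "c = coeff p (Suc n) / coeff ?g (Suc n)"
  have g: "coeff ?g (Suc n) \<noteq> 0" "degree ?g \<le> Suc n"
    using degree_coeff_geg[OF lam, of "Suc n"] degree_map_poly_le[of complex_of_real "geg lam (Suc n)"]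
    by (auto simp: coeff_cpoly simp del: geg.simps)
  have "degree (p - Polynomial.smult c ?g) \<le> n"
  proof (rule degree_le, intro allI impI)
    fix i assume "n < i"
    then consider "i = Suc n" | "i > Suc n" by linarith
    then show "coeff (p - Polynomial.smult c ?g) i = 0"
    proof cases
      case 1
      then show ?thesis using g(1) by (simp add: c_def del: geg.simps)
    next
      case 2
      then have "coeff p i = 0" "coeff ?g i = 0" using Suc.prems g(2) by (auto intro!: coeff_eq_0 simp del: geg.simps)
      then show ?thesis by (simp del: geg.simps)
    qed
  qed
  then obtain x where x: "p - Polynomial.smult c ?g = geg_poly lam n x" using Suc.IH by blast
  let ?x = "x(Suc n := c * complex_of_real (sqrt (geg_h lam (Suc n))))"
  have "geg_h lam (Suc n) > 0" by (rule geg_h_pos[OF lam])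
  then have "geg_poly lam (Suc n) ?x = geg_poly lam n x + Polynomial.smult c ?g"
    by (simp add: geg_poly_def del: geg.simps)
  then have "p = geg_poly lam (Suc n) ?x" unfolding x[symmetric] by simp
  then show ?case by blast
qed

lemma Re_of_real_mult: "Re (complex_of_real r * z) = r * Re z"
  by simp

text \<open>At real points the polynomials F_j are real, so the squared modulus is itself a real
  polynomial and only the real parts of the coefficient products remain.\<close>

lemma wnorm_sum:
  assumes lam: "lam > - 1/2"
  shows "wnorm lam (\<Sum>j\<in>A. Polynomial.smult (c j) (cpoly (F j)))
    = sqrt (\<Sum>i\<in>A. \<Sum>j\<in>A. Re (c i * cnj (c j)) * geg_int lam (F i * F j))"
proof -
  let ?p = "\<Sum>j\<in>A. Polynomial.smult (c j) (cpoly (F j))"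
  let ?q = "\<Sum>i\<in>A. \<Sum>j\<in>A. Polynomial.smult (Re (c i * cnj (c j))) (F i * F j)"
  have "(cmod (poly ?p (complex_of_real t)))\<^sup>2 = poly ?q t" for t
  proof -
    let ?z = "\<Sum>j\<in>A. c j * complex_of_real (poly (F j) t)"
    have "(cmod (poly ?p (complex_of_real t)))\<^sup>2 = (cmod ?z)\<^sup>2"
      by (simp add: poly_sum poly_cpoly)
    also have "\<dots> = Re (?z * cnj ?z)"
      by (metis Re_complex_of_real complex_norm_square)
    also have "?z * cnj ?z = (\<Sum>i\<in>A. \<Sum>j\<in>A. complex_of_real (poly (F i) t * poly (F j) t) * (c i * cnj (c j)))"
      by (simp add: sum_product mult_ac)
    also have "Re \<dots> = poly ?q t"
      unfolding Re_sum Re_of_real_mult poly_sum poly_smult poly_mult by (simp only: mult_ac)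
    finally show ?thesis .
  qed
  then have "wnorm lam ?p = sqrt (geg_int lam ?q)"
    by (simp only: wnorm_def geg_int_def)
  also have "geg_int lam ?q = (\<Sum>i\<in>A. \<Sum>j\<in>A. Re (c i * cnj (c j)) * geg_int lam (F i * F j))"
    by (simp only: geg_int_sum[OF lam] geg_int_smult)
  finally show ?thesis .
qed

lemma wnorm_geg_poly:
  assumes lam: "lam > - 1/2"
  shows "wnorm lam (geg_poly lam n x) = sqrt (\<Sum>j\<le>n. (cmod (x j))\<^sup>2)"
proof -
  let ?c = "\<lambda>j. x j / complex_of_real (sqrt (geg_h lam j))"
  have "(\<Sum>i\<le>n. \<Sum>j\<le>n. Re (?c i * cnj (?c j)) * geg_int lam (geg lam i * geg lam j))
      = (\<Sum>i\<le>n. \<Sum>j\<le>n. if i = j then (cmod (x i))\<^sup>2 else 0)"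
  proof (intro sum.cong refl)
    fix i j
    show "Re (?c i * cnj (?c j)) * geg_int lam (geg lam i * geg lam j) = (if i = j then (cmod (x i))\<^sup>2 else 0)"
    proof (cases "i = j")
      case True
      have h: "geg_h lam i > 0" by (rule geg_h_pos[OF lam])
      have "Re (?c i * cnj (?c i)) = (cmod (?c i))\<^sup>2"
        by (metis Re_complex_of_real complex_norm_square)
      also have "\<dots> = (cmod (x i))\<^sup>2 / geg_h lam i"
        using h by (simp add: norm_divide power_divide)
      finally show ?thesis using True h by (simp add: geg_h_def[symmetric])
    qed (simp add: geg_orthogonal[OF lam])
  qed
  then show ?thesis
    unfolding geg_poly_def wnorm_sum[OF lam] by simp
qed

lemma wnorm_pderiv_geg_poly:
  assumes lam: "lam > - 1/2"
  shows "wnorm lam (pderiv (geg_poly lam n x))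
    = 2 * sqrt (\<Sum>i\<le>n. \<Sum>j\<le>n. if even (i + j) then geg_G lam i j * Re (x i * cnj (x j)) else 0)"
proof -
  let ?c = "\<lambda>j. x j / complex_of_real (sqrt (geg_h lam j))"
  have 1: "pderiv (geg_poly lam n x) = (\<Sum>j\<le>n. Polynomial.smult (?c j) (cpoly (pderiv (geg lam j))))"
    by (simp add: geg_poly_def pderiv_sum pderiv_smult pderiv_cpoly)
  have "(\<Sum>i\<le>n. \<Sum>j\<le>n. Re (?c i * cnj (?c j)) * geg_int lam (pderiv (geg lam i) * pderiv (geg lam j)))
      = (\<Sum>i\<le>n. \<Sum>j\<le>n. 4 * (if even (i + j) then geg_G lam i j * Re (x i * cnj (x j)) else 0))"
  proof (intro sum.cong refl)
    fix i j
    have h: "geg_h lam i > 0" "geg_h lam j > 0" by (rule geg_h_pos[OF lam])+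
    have "?c i * cnj (?c j) = complex_of_real (1 / (sqrt (geg_h lam i) * sqrt (geg_h lam j))) * (x i * cnj (x j))"
      by simp
    then have "Re (?c i * cnj (?c j)) = Re (x i * cnj (x j)) / (sqrt (geg_h lam i) * sqrt (geg_h lam j))"
      by (simp only: Re_of_real_mult) simp
    then show "Re (?c i * cnj (?c j)) * geg_int lam (pderiv (geg lam i) * pderiv (geg lam j))
        = 4 * (if even (i + j) then geg_G lam i j * Re (x i * cnj (x j)) else 0)"
      using h unfolding geg_int_pderiv[OF lam] by simp
  qed
  then show ?thesis
    unfolding 1 wnorm_sum[OF lam] by (simp add: real_sqrt_mult flip: sum_distrib_left)
qed

section \<open>The extremal problem\<close>

lemma sum_sum_restrict:
  fixes f :: "'a \<Rightarrow> 'a \<Rightarrow> real"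
  assumes "finite A" "S \<subseteq> A"
  shows "(\<Sum>i\<in>A. \<Sum>j\<in>A. if i \<in> S \<and> j \<in> S then f i j else 0) = (\<Sum>i\<in>S. \<Sum>j\<in>S. f i j)"
proof -
  have S: "A \<inter> S = S" using assms by auto
  have "(\<Sum>i\<in>A. \<Sum>j\<in>A. if i \<in> S \<and> j \<in> S then f i j else 0)
      = (\<Sum>i\<in>A. if i \<in> S then (\<Sum>j\<in>A. if j \<in> S then f i j else 0) else 0)"
    by (intro sum.cong) auto
  also have "\<dots> = (\<Sum>i\<in>S. \<Sum>j\<in>S. f i j)"
    by (simp only: sum.inter_restrict[OF assms(1), symmetric] S)
  finally show ?thesis .
qed

text \<open>Equality of real part and modulus forces a * cnj b to be real and nonnegative;
  multiplying by b recovers a.\<close>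

lemma eq_cmod_sgn_of_Re_mult_cnj:
  assumes "Re (a * cnj b) = cmod a * cmod b" "b \<noteq> 0"
  shows "a = complex_of_real (cmod a) * sgn b"
proof -
  have "cmod (a * cnj b) = Re (a * cnj b)" using assms by (simp add: norm_mult)
  then have "Im (a * cnj b) = 0"
    using cmod_power2[of "a * cnj b"] by simp
  then have "a * cnj b = complex_of_real (cmod a * cmod b)"
    using assms by (simp add: complex_eq_iff)
  then have "a * cnj b * b = complex_of_real (cmod a * cmod b) * b" by simp
  moreover have "a * cnj b * b = a * complex_of_real ((cmod b)\<^sup>2)"
    by (simp only: complex_norm_square mult.assoc mult.commute[of b])
  ultimately have "(a - complex_of_real (cmod a) * sgn b) * complex_of_real ((cmod b)\<^sup>2) = 0"
    using assms(2) by (simp add: sgn_div_norm scaleR_conv_of_real field_simps power2_eq_square)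
  then show ?thesis using assms(2) by simp
qed

text \<open>
  \<open>I\<close> is the parity class of \<open>n\<close> and \<open>J\<close> the opposite one. The degree \<open>0\<close> is left out of \<open>I\<close>, as
  constants have zero derivative; it may belong to \<open>J\<close>.
\<close>

context
  fixes lam :: real and n :: nat and I J :: "nat set" and M :: real
  assumes lam: "lam > - 1/2" and n: "n \<ge> 1"
    and I: "I = {j. 1 \<le> j \<and> j \<le> n \<and> even (n - j)}"
    and J: "J = {j. j \<le> n \<and> odd (n - j)}"
    and max: "\<And>z. quad (geg_G lam) I z \<le> M * (\<Sum>i\<in>I. (z i)\<^sup>2)"
    and attained: "\<exists>y. (\<Sum>i\<in>I. (y i)\<^sup>2) = 1 \<and> quad (geg_G lam) I y = M"
begin

private lemma fin: "finite I" "finite J" and sub: "I \<subseteq> {..n}" "J \<subseteq> {..n}" and nI: "n \<in> I" and disj: "I \<inter> J = {}"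
  using n by (auto simp: I J)

private lemma M_pos: "M > 0"
proof -
  let ?z = "\<lambda>i. if i = n then 1 else (0 :: real)"
  have "(\<Sum>i\<in>I. (?z i)\<^sup>2) = (\<Sum>i\<in>I. ?z i)" by (intro sum.cong) auto
  then have 1: "(\<Sum>i\<in>I. (?z i)\<^sup>2) = 1" using fin nI by simp
  have "quad (geg_G lam) I ?z = (\<Sum>i\<in>I. if i = n then (\<Sum>j\<in>I. if j = n then geg_G lam n n else 0) else 0)"
    unfolding quad_def by (intro sum.cong refl) (auto intro!: sum.cong)
  also have "\<dots> = geg_G lam n n" using fin nI by simp
  finally show ?thesis using max[of ?z] geg_G_pos[OF lam, of n n] n 1 by simp
qed

private definition form :: "nat set \<Rightarrow> (nat \<Rightarrow> complex) \<Rightarrow> real" where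
  "form S x = (\<Sum>i\<in>S. \<Sum>j\<in>S. geg_G lam i j * Re (x i * cnj (x j)))"

text \<open>For even n the degree 0 lies in neither class, but its terms vanish with
  \<open>geg_G lam 0 j\<close>.\<close>

private lemma form_split:
  "(\<Sum>i\<le>n. \<Sum>j\<le>n. if even (i + j) then geg_G lam i j * Re (x i * cnj (x j)) else 0) = form I x + form J x"
proof -
  let ?f = "\<lambda>i j. geg_G lam i j * Re (x i * cnj (x j))"
  have "(\<Sum>i\<le>n. \<Sum>j\<le>n. if even (i + j) then ?f i j else 0)
    = (\<Sum>i\<le>n. \<Sum>j\<le>n. (if i \<in> I \<and> j \<in> I then ?f i j else 0) + (if i \<in> J \<and> j \<in> J then ?f i j else 0))"
  proof (intro sum.cong refl)
    fix i j assume "i \<in> {..n}" "j \<in> {..n}"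
    then have "i \<in> J \<longleftrightarrow> odd (n + i)" "j \<in> J \<longleftrightarrow> odd (n + j)"
      "i \<in> I \<longleftrightarrow> i \<noteq> 0 \<and> even (n + i)" "j \<in> I \<longleftrightarrow> j \<noteq> 0 \<and> even (n + j)"
      by (auto simp: I J)
    then show "(if even (i + j) then ?f i j else 0)
        = (if i \<in> I \<and> j \<in> I then ?f i j else 0) + (if i \<in> J \<and> j \<in> J then ?f i j else 0)"
      by (cases "i = 0"; cases "j = 0"; cases "even n"; cases "even i"; cases "even j") simp_all
  qed
  then show ?thesis
    by (simp only: sum.distrib sum_sum_restrict[OF finite_atMost sub(1)] sum_sum_restrict[OF finite_atMost sub(2)] form_def)
qed

private lemma wnorm_pderiv: "wnorm lam (pderiv (geg_poly lam n x)) = 2 * sqrt (form I x + form J x)"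
  by (simp only: wnorm_pderiv_geg_poly[OF lam] form_split)

private lemma G_nonneg: "geg_G lam i j \<ge> 0"
  using geg_G_pos[OF lam, of i j] by (cases "i = 0"; cases "j = 0") auto

private lemma form_term_le: "geg_G lam i j * Re (x i * cnj (x j)) \<le> geg_G lam i j * cmod (x i) * cmod (x j)"
proof -
  have "Re (x i * cnj (x j)) \<le> cmod (x i) * cmod (x j)"
    using complex_Re_le_cmod[of "x i * cnj (x j)"] by (simp add: norm_mult)
  then show ?thesis using G_nonneg by (simp add: mult_left_mono mult.assoc)
qed

private lemma form_le: "form S x \<le> quad (geg_G lam) S (\<lambda>j. cmod (x j))"
  unfolding form_def quad_def by (intro sum_mono form_term_le)

text \<open>Moving the entry at j to j + 1 carries J into I, preserves the sum of squares and does
  not decrease the form. If y k > 0, the diagonal term at k already grows strictly.\<close>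

private lemma quad_J_le:
  assumes y: "\<And>j. y j \<ge> 0"
  shows "quad (geg_G lam) J y \<le> M * (\<Sum>j\<in>J. (y j)\<^sup>2)"
    and "\<lbrakk>k \<in> J; y k > 0\<rbrakk> \<Longrightarrow> quad (geg_G lam) J y < M * (\<Sum>j\<in>J. (y j)\<^sup>2)"
proof -
  let ?z = "\<lambda>j. if j \<in> Suc ` J then y (j - 1) else 0"
  have S: "Suc ` J \<subseteq> I"
  proof
    fix i assume "i \<in> Suc ` J"
    then obtain j where j: "i = Suc j" "j \<le> n" "odd (n - j)" by (auto simp: J)
    \<comment> \<open>n itself is not in J, so the shift does not leave the range of
      degrees.\<close>
    then have "j < n" by (metis diff_self_eq_0 dvd_0_right le_neq_implies_less)
    with j show "i \<in> I" by (auto simp: I)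
  qed
  have restr: "I \<inter> Suc ` J = Suc ` J" using S by auto
  have inj: "inj_on Suc J" by simp
  have "(\<Sum>i\<in>I. (?z i)\<^sup>2) = (\<Sum>i\<in>I. if i \<in> Suc ` J then (y (i - 1))\<^sup>2 else 0)"
    by (intro sum.cong) auto
  also have "\<dots> = (\<Sum>j\<in>J. (y j)\<^sup>2)"
    by (simp add: sum.inter_restrict[OF fin(1), symmetric] restr sum.reindex[OF inj])
  finally have 1: "(\<Sum>i\<in>I. (?z i)\<^sup>2) = (\<Sum>j\<in>J. (y j)\<^sup>2)" .
  have "quad (geg_G lam) I ?z
      = (\<Sum>i\<in>I. \<Sum>j\<in>I. if i \<in> Suc ` J \<and> j \<in> Suc ` J then geg_G lam i j * y (i - 1) * y (j - 1) else 0)"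
    unfolding quad_def by (intro sum.cong) auto
  also have "\<dots> = (\<Sum>i\<in>J. \<Sum>j\<in>J. geg_G lam (Suc i) (Suc j) * y i * y j)"
    by (simp add: sum_sum_restrict[OF fin(1) S] sum.reindex[OF inj])
  finally have 2: "(\<Sum>i\<in>J. \<Sum>j\<in>J. geg_G lam (Suc i) (Suc j) * y i * y j) \<le> M * (\<Sum>j\<in>J. (y j)\<^sup>2)"
    using max[of ?z] unfolding 1 by simp
  have 3: "geg_G lam i j * y i * y j \<le> geg_G lam (Suc i) (Suc j) * y i * y j" for i j
    using geg_G_less_Suc[OF lam, of i j] y by (intro mult_right_mono) auto
  then have "quad (geg_G lam) J y \<le> (\<Sum>i\<in>J. \<Sum>j\<in>J. geg_G lam (Suc i) (Suc j) * y i * y j)"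
    unfolding quad_def by (intro sum_mono)
  with 2 show "quad (geg_G lam) J y \<le> M * (\<Sum>j\<in>J. (y j)\<^sup>2)" by simp
  assume k: "k \<in> J" "y k > 0"
  have "geg_G lam k k * y k * y k < geg_G lam (Suc k) (Suc k) * y k * y k"
    using geg_G_less_Suc[OF lam, of k k] k by (intro mult_strict_right_mono) auto
  then have "(\<Sum>j\<in>J. geg_G lam k j * y k * y j) < (\<Sum>j\<in>J. geg_G lam (Suc k) (Suc j) * y k * y j)"
    using k(1) 3 fin(2) by (intro sum_strict_mono_ex1) blast+
  then have "quad (geg_G lam) J y < (\<Sum>i\<in>J. \<Sum>j\<in>J. geg_G lam (Suc i) (Suc j) * y i * y j)"
    unfolding quad_def using k 3 fin(2) by (intro sum_strict_mono_ex1) (auto intro!: sum_mono)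
  with 2 show "quad (geg_G lam) J y < M * (\<Sum>j\<in>J. (y j)\<^sup>2)" by simp
qed

text \<open>An inequality only, since for even n the degree 0 is missing on the left.\<close>

private lemma sum_split_le:
  fixes f :: "nat \<Rightarrow> real"
  assumes "\<And>j. f j \<ge> 0"
  shows "sum f I + sum f J \<le> sum f {..n}"
  using sum_mono2[of "{..n}" "I \<union> J" f] sum.union_disjoint[OF fin disj, of f] sub assms by auto

private lemma form_bound: "form I x + form J x \<le> M * (\<Sum>j\<le>n. (cmod (x j))\<^sup>2)"
proof -
  have "form I x \<le> M * (\<Sum>j\<in>I. (cmod (x j))\<^sup>2)" "form J x \<le> M * (\<Sum>j\<in>J. (cmod (x j))\<^sup>2)"
    using form_le[of I x] form_le[of J x] max[of "\<lambda>j. cmod (x j)"] quad_J_le(1)[of "\<lambda>j. cmod (x j)"] by auto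
  then have "form I x + form J x \<le> M * ((\<Sum>j\<in>I. (cmod (x j))\<^sup>2) + (\<Sum>j\<in>J. (cmod (x j))\<^sup>2))"
    by (simp add: distrib_left)
  also have "\<dots> \<le> M * (\<Sum>j\<le>n. (cmod (x j))\<^sup>2)"
    using M_pos by (intro mult_left_mono sum_split_le) auto
  finally show ?thesis .
qed

lemma markov_const_eq: "markov_const n lam = ereal (2 * sqrt M)"
  unfolding markov_const_def
proof (rule antisym)
  show "(SUP f\<in>{f. degree f \<le> n \<and> f \<noteq> 0}. ereal (wnorm lam (pderiv f) / wnorm lam f)) \<le> ereal (2 * sqrt M)"
  proof (rule SUP_least)
    fix f :: "complex poly" assume "f \<in> {f. degree f \<le> n \<and> f \<noteq> 0}"
    then obtain x where x: "f = geg_poly lam n x" using geg_poly_exists[OF lam] by auto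
    let ?s = "\<Sum>j\<le>n. (cmod (x j))\<^sup>2"
    have "wnorm lam (pderiv f) \<le> 2 * sqrt (M * ?s)"
      unfolding x wnorm_pderiv using form_bound[of x] by simp
    also have "\<dots> = 2 * sqrt M * wnorm lam f"
      unfolding x wnorm_geg_poly[OF lam] by (simp add: real_sqrt_mult)
    finally have "wnorm lam (pderiv f) \<le> 2 * sqrt M * wnorm lam f" .
    moreover have "wnorm lam f \<ge> 0" unfolding x wnorm_geg_poly[OF lam] by (simp add: sum_nonneg)
    \<comment> \<open>In the case of norm 0 the quotient is 0 by the convention for
      division.\<close>
    ultimately show "ereal (wnorm lam (pderiv f) / wnorm lam f) \<le> ereal (2 * sqrt M)"
      using M_pos by (cases "wnorm lam f = 0") (auto simp: divide_le_eq less_imp_le)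
  qed
  obtain y where y: "(\<Sum>i\<in>I. (y i)\<^sup>2) = 1" "quad (geg_G lam) I y = M" using attained by blast
  define x where "x = (\<lambda>j. if j \<in> I then complex_of_real (y j) else 0)"
  have "(\<Sum>j\<le>n. (cmod (x j))\<^sup>2) = (\<Sum>j\<le>n. if j \<in> I then (y j)\<^sup>2 else 0)"
    by (intro sum.cong) (auto simp: x_def)
  also have "\<dots> = (\<Sum>j\<in>{..n} \<inter> I. (y j)\<^sup>2)" by (simp only: sum.inter_restrict finite_atMost)
  also have "{..n} \<inter> I = I" using sub by auto
  finally have 1: "wnorm lam (geg_poly lam n x) = 1"
    unfolding wnorm_geg_poly[OF lam] by (simp add: y)
  have "form I x = quad (geg_G lam) I y"
    unfolding form_def quad_def x_def by (intro sum.cong) auto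
  moreover have "form J x = 0"
    unfolding form_def x_def using disj by (intro sum.neutral ballI) auto
  ultimately have 2: "wnorm lam (pderiv (geg_poly lam n x)) = 2 * sqrt M"
    unfolding wnorm_pderiv by (simp add: y)
  have "geg_poly lam n x \<noteq> 0"
    using 1 by (auto simp: wnorm_def)
  then have "geg_poly lam n x \<in> {f. degree f \<le> n \<and> f \<noteq> 0}"
    using degree_geg_poly[OF lam] by simp
  from SUP_upper[OF this, of "\<lambda>f. ereal (wnorm lam (pderiv f) / wnorm lam f)"]
  show "ereal (2 * sqrt M) \<le> (SUP f\<in>{f. degree f \<le> n \<and> f \<noteq> 0}. ereal (wnorm lam (pderiv f) / wnorm lam f))"
    by (simp add: 1 2)
qed

text \<open>Extremality turns every inequality behind \<open>form_bound\<close> into an equality.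
  Strictness on J removes the opposite parity, and on I the moduli are a maximiser, hence
  positive.\<close>

lemma extremal_poly_form:
  assumes "extremal_poly n lam p"
  shows "\<exists>\<theta> s. (\<forall>j\<in>I. s j > 0)
    \<and> p = Polynomial.smult (exp (\<i> * complex_of_real \<theta>))
            (\<Sum>j\<in>I. Polynomial.smult (complex_of_real (s j)) (cpoly (geg lam j)))"
proof -
  have p: "degree p \<le> n" "p \<noteq> 0" and ext: "wnorm lam (pderiv p) = 2 * sqrt M * wnorm lam p"
    using assms unfolding extremal_poly_def markov_const_eq by auto
  obtain x where x: "p = geg_poly lam n x" using geg_poly_exists[OF lam p(1)] by blast
  define y where "y = (\<lambda>j. cmod (x j))"
  have y_nonneg: "y j \<ge> 0" for j by (simp add: y_def)
  have "sqrt (form I x + form J x) = sqrt (M * (\<Sum>j\<le>n. (y j)\<^sup>2))"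
    using ext unfolding x wnorm_pderiv wnorm_geg_poly[OF lam] by (simp add: real_sqrt_mult y_def)
  then have tot: "form I x + form J x = M * (\<Sum>j\<le>n. (y j)\<^sup>2)" by simp
  have I1: "form I x \<le> quad (geg_G lam) I y" and I2: "quad (geg_G lam) I y \<le> M * (\<Sum>j\<in>I. (y j)\<^sup>2)"
    unfolding y_def by (rule form_le, rule max)
  have J1: "form J x \<le> quad (geg_G lam) J y" and J2: "quad (geg_G lam) J y \<le> M * (\<Sum>j\<in>J. (y j)\<^sup>2)"
    unfolding y_def by (rule form_le, rule quad_J_le(1)) simp
  have IJ: "M * (\<Sum>j\<in>I. (y j)\<^sup>2) + M * (\<Sum>j\<in>J. (y j)\<^sup>2) \<le> M * (\<Sum>j\<le>n. (y j)\<^sup>2)"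
    unfolding distrib_left[symmetric] using M_pos by (intro mult_left_mono sum_split_le) auto
  have Ieq: "form I x = quad (geg_G lam) I y" "quad (geg_G lam) I y = M * (\<Sum>j\<in>I. (y j)\<^sup>2)"
    and Jeq: "quad (geg_G lam) J y = M * (\<Sum>j\<in>J. (y j)\<^sup>2)"
    and IJeq: "M * (\<Sum>j\<in>I. (y j)\<^sup>2) + M * (\<Sum>j\<in>J. (y j)\<^sup>2) = M * (\<Sum>j\<le>n. (y j)\<^sup>2)"
    using tot I1 I2 J1 J2 IJ by linarith+
  have yJ: "y k = 0" if "k \<in> J" for k
  proof (rule ccontr)
    assume "y k \<noteq> 0"
    then have "y k > 0" using y_nonneg[of k] by simp
    with quad_J_le(2)[of y k] y_nonneg that Jeq show False by simp
  qed
  then have sJ: "(\<Sum>j\<in>J. (y j)\<^sup>2) = 0" by simp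
  \<comment> \<open>Beyond J, this also removes the constant term when n is even.\<close>
  have y0: "y k = 0" if "k \<in> {..n} - I" for k
  proof -
    have "(\<Sum>j\<in>{..n}. (y j)\<^sup>2) = (\<Sum>j\<in>I. (y j)\<^sup>2)"
      using IJeq M_pos unfolding sJ by simp
    moreover have "(\<Sum>j\<in>{..n}. (y j)\<^sup>2) = (\<Sum>j\<in>{..n} - I. (y j)\<^sup>2) + (\<Sum>j\<in>I. (y j)\<^sup>2)"
      using sub(1) by (intro sum.subset_diff) auto
    ultimately have "(\<Sum>j\<in>{..n} - I. (y j)\<^sup>2) = 0" by simp
    then show ?thesis using that by (simp add: sum_nonneg_eq_0_iff)
  qed
  have gp: "geg_poly lam n x
      = (\<Sum>j\<in>I. Polynomial.smult (x j / complex_of_real (sqrt (geg_h lam j))) (cpoly (geg lam j)))"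
    unfolding geg_poly_def
    by (intro sum.mono_neutral_right) (use sub(1) y0 in \<open>auto simp: y_def\<close>)
  have nz: "\<exists>i\<in>I. y i \<noteq> 0"
  proof (rule ccontr)
    assume "\<not> ?thesis"
    then have "geg_poly lam n x = 0" unfolding gp by (intro sum.neutral) (auto simp: y_def)
    with p(2) x show False by simp
  qed
  have y_pos: "y k > 0" if "k \<in> I" for k
    by (rule perron_positive[where G = "geg_G lam" and I = I and M = M])
       (use fin(1) max Ieq(2) nz that y_nonneg geg_G_sym geg_G_pos[OF lam] in \<open>auto simp: I\<close>)
  have Re_eq: "Re (x k * cnj (x n)) = cmod (x k) * cmod (x n)" if "k \<in> I" for k
  proof -
    \<comment> \<open>All terms are nonnegative, so each one vanishes; the terms (k, n) align every
      coefficient with x n, whose argument becomes \<theta>.\<close>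
    have "(\<Sum>i\<in>I. \<Sum>j\<in>I. geg_G lam i j * y i * y j - geg_G lam i j * Re (x i * cnj (x j))) = 0"
      using Ieq(1) unfolding form_def quad_def sum_subtractf by simp
    moreover have nn: "geg_G lam i j * y i * y j - geg_G lam i j * Re (x i * cnj (x j)) \<ge> 0" for i j
      using form_term_le[of i j x] by (simp add: y_def)
    ultimately have "(\<Sum>j\<in>I. geg_G lam k j * y k * y j - geg_G lam k j * Re (x k * cnj (x j))) = 0"
      using that fin(1) by (subst (asm) sum_nonneg_eq_0_iff) (auto intro!: sum_nonneg)
    then have "geg_G lam k n * y k * y n - geg_G lam k n * Re (x k * cnj (x n)) = 0"
      using nn nI fin(1) by (subst (asm) sum_nonneg_eq_0_iff) auto
    moreover have "geg_G lam k n > 0" using that n by (intro geg_G_pos[OF lam]) (auto simp: I)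
    ultimately have "y k * y n - Re (x k * cnj (x n)) = 0"
      unfolding mult.assoc right_diff_distrib[symmetric] by (metis less_irrefl mult_eq_0_iff)
    then show ?thesis by (simp only: y_def right_minus_eq)
  qed
  have xn: "x n \<noteq> 0" using y_pos[OF nI] by (auto simp: y_def)
  then obtain \<theta> where \<theta>: "sgn (x n) = exp (\<i> * complex_of_real \<theta>)"
    using complex_norm_eq_1_exp[of "sgn (x n)"] by (metis norm_sgn)
  let ?s = "\<lambda>j. y j / sqrt (geg_h lam j)"
  have "p = Polynomial.smult (exp (\<i> * complex_of_real \<theta>))
        (\<Sum>j\<in>I. Polynomial.smult (complex_of_real (?s j)) (cpoly (geg lam j)))"
    unfolding x gp smult_sum2 smult_smult
  proof (intro sum.cong refl)
    fix j assume "j \<in> I"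
    then have "x j = complex_of_real (y j) * exp (\<i> * complex_of_real \<theta>)"
      using eq_cmod_sgn_of_Re_mult_cnj[OF Re_eq xn] unfolding \<theta> y_def by blast
    then have "x j / complex_of_real (sqrt (geg_h lam j)) = exp (\<i> * complex_of_real \<theta>) * complex_of_real (?s j)"
      by simp
    then show "Polynomial.smult (x j / complex_of_real (sqrt (geg_h lam j))) (cpoly (geg lam j))
        = Polynomial.smult (exp (\<i> * complex_of_real \<theta>) * complex_of_real (?s j)) (cpoly (geg lam j))"
      by (simp only:)
  qed
  moreover have "\<forall>j\<in>I. ?s j > 0" using y_pos geg_h_pos[OF lam] by simp
  ultimately show ?thesis by (intro exI[of _ \<theta>] exI[of _ ?s] conjI)
qed

end

text \<open>Parity is available at real points only; stated as an identity of polynomials through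
  \<open>pcompose\<close>, it passes to complex arguments.\<close>

lemma poly_cpoly_geg_minus: "poly (cpoly (geg lam k)) (- z) = (- 1) ^ k * poly (cpoly (geg lam k)) z"
proof -
  have "pcompose (geg lam k) [:0, -1:] = Polynomial.smult ((- 1) ^ k) (geg lam k)"
    by (rule poly_ext) (simp add: poly_pcompose poly_geg_minus)
  then have "cpoly (pcompose (geg lam k) [:0, -1:]) = Polynomial.smult ((- 1) ^ k) (cpoly (geg lam k))"
    by (simp add: map_poly_smult)
  moreover have "cpoly (pcompose (geg lam k) [:0, -1:]) = pcompose (cpoly (geg lam k)) [:0, -1:]"
    by (simp add: of_real_hom.map_poly_pcompose map_poly_pCons)
  ultimately have "poly (pcompose (cpoly (geg lam k)) [:0, -1:]) z = (- 1) ^ k * poly (cpoly (geg lam k)) z"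
    by simp
  then show ?thesis by (simp add: poly_pcompose)
qed

lemma parity_class_eq:
  fixes n :: nat
  assumes "n \<ge> 1"
  shows "{j. 1 \<le> j \<and> j \<le> n \<and> even (n - j)} = (\<lambda>k. n - 2 * k) ` {0..(n - 1) div 2}"
proof (intro equalityI subsetI)
  fix j assume "j \<in> {j. 1 \<le> j \<and> j \<le> n \<and> even (n - j)}"
  then have "even (n - j)" "1 \<le> j" "j \<le> n" by blast+
  then obtain k where "n - j = 2 * k" "1 \<le> j" "j \<le> n" by (elim evenE)
  then show "j \<in> (\<lambda>k. n - 2 * k) ` {0..(n - 1) div 2}"
    by (intro image_eqI[of _ _ k]) auto
qed (use assms in auto)

lemma cpoly_gegenbauer:
  assumes "j \<ge> 1"
  shows "cpoly (gegenbauer lam j) = Polynomial.smult (complex_of_real (if lam = 0 then 1 else lam)) (cpoly (geg lam j))"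
  using gegenbauer_eq_smult_geg[of lam "j - 1"] assms by (simp add: map_poly_smult del: geg.simps)

theorem theorem3p2:
  fixes lam :: real and n :: nat
  assumes "lam > - 1/2" and "n \<ge> 1"
  shows "(\<forall>m. n = 2 * m \<longrightarrow> markov_const n lam = ereal (2 * sqrt (nu lam m)))
    \<and> (\<forall>m. n = 2 * m + 1 \<longrightarrow> markov_const n lam = ereal (2 * sqrt (nu_tilde lam (m + 1))))
    \<and> (\<forall>p. extremal_poly n lam p \<longrightarrow>
          (\<exists>(\<theta>::real) (t :: nat \<Rightarrow> real).
              t n > 0
            \<and> (\<forall>k\<in>{1..(n - 1) div 2}. t (n - 2 * k) \<ge> 0)
            \<and> p = Polynomial.smult (exp (\<i> * complex_of_real \<theta>))
                    (\<Sum>k = 0..(n - 1) div 2.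
                       Polynomial.smult (complex_of_real (t (n - 2 * k)))
                         (map_poly complex_of_real (gegenbauer lam (n - 2 * k)))))
        \<and> (even n \<longrightarrow> (\<forall>z. poly p (- z) = poly p z))
        \<and> (odd n \<longrightarrow> (\<forall>z. poly p (- z) = - poly p z)))"
proof -
  note lam = assms(1) and n = assms(2)
  define I where "I = {j. 1 \<le> j \<and> j \<le> n \<and> even (n - j)}"
  define J where "J = {j. j \<le> n \<and> odd (n - j)}"
  \<comment> \<open>The equation n + 1 = 2 * m + e treats both parities together: e = 1 is n = 2m,
    while e = 0 is n = 2m - 1, so that m plays the role of m + 1 in the odd case of the
    theorem.\<close>
  have spec: "quad (geg_G lam) I z \<le> Max (spectrum A) * (\<Sum>i\<in>I. (z i)\<^sup>2)"
      "\<exists>y. (\<Sum>i\<in>I. (y i)\<^sup>2) = 1 \<and> quad (geg_G lam) I y = Max (spectrum A)"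
    if "n + 1 = 2 * m + e" "e \<le> 1"
      "A = Matrix.mat m m (\<lambda>(i, j). geg_G lam (Suc (2 * i + e)) (Suc (2 * j + e)))" for A m e z
  proof -
    have m: "m > 0" using that n by auto
    have inj: "inj_on (\<lambda>i. Suc (2 * i + e)) {..<m}" by (auto simp: inj_on_def)
    have I: "I = (\<lambda>i. Suc (2 * i + e)) ` {..<m}"
    proof (intro equalityI subsetI)
      fix j assume "j \<in> I"
      then have "even (n - j)" "1 \<le> j" "j \<le> n" unfolding I_def by blast+
      then obtain k where "n - j = 2 * k" "1 \<le> j" "j \<le> n" by (elim evenE)
      then show "j \<in> (\<lambda>i. Suc (2 * i + e)) ` {..<m}"
        using that by (intro image_eqI[of _ _ "m - 1 - k"]) auto
    next
      fix j assume "j \<in> (\<lambda>i. Suc (2 * i + e)) ` {..<m}"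
      then obtain i where "j = Suc (2 * i + e)" "i < m" by auto
      then have "n - j = 2 * (m - 1 - i)" "1 \<le> j" "j \<le> n" using that by auto
      then show "j \<in> I" unfolding I_def by (metis (mono_tags) dvd_triv_left mem_Collect_eq)
    qed
    show "quad (geg_G lam) I z \<le> Max (spectrum A) * (\<Sum>i\<in>I. (z i)\<^sup>2)"
      "\<exists>y. (\<Sum>i\<in>I. (y i)\<^sup>2) = 1 \<and> quad (geg_G lam) I y = Max (spectrum A)"
      by (rule Max_spectrum_quad[OF m inj I geg_G_sym that(3)])+
  qed
  obtain M where M: "\<And>z. quad (geg_G lam) I z \<le> M * (\<Sum>i\<in>I. (z i)\<^sup>2)"
      "\<exists>y. (\<Sum>i\<in>I. (y i)\<^sup>2) = 1 \<and> quad (geg_G lam) I y = M"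
    and nu: "\<And>m. n = 2 * m \<Longrightarrow> nu lam m = M" "\<And>m. n = 2 * m + 1 \<Longrightarrow> nu_tilde lam (m + 1) = M"
  proof (cases "even n")
    case True
    then obtain m where m: "n = 2 * m" by auto
    show ?thesis
    proof (rule that[of "nu lam m"])
      show "quad (geg_G lam) I z \<le> nu lam m * (\<Sum>i\<in>I. (z i)\<^sup>2)" for z
        unfolding nu_def by (rule spec(1)[OF _ order_refl A_mat_eq[OF lam]]) (use m in simp)
      show "\<exists>y. (\<Sum>i\<in>I. (y i)\<^sup>2) = 1 \<and> quad (geg_G lam) I y = nu lam m"
        unfolding nu_def by (rule spec(2)[OF _ order_refl A_mat_eq[OF lam]]) (use m in simp)
    qed (use m in \<open>auto, presburger\<close>)
  next
    case False
    then obtain m where m: "n = 2 * m + 1" by (auto elim: oddE)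
    show ?thesis
    proof (rule that[of "nu_tilde lam (m + 1)"])
      show "quad (geg_G lam) I z \<le> nu_tilde lam (m + 1) * (\<Sum>i\<in>I. (z i)\<^sup>2)" for z
        unfolding nu_tilde_def by (rule spec(1)[OF _ le0 A_tilde_mat_eq[OF lam]]) (use m in simp)
      show "\<exists>y. (\<Sum>i\<in>I. (y i)\<^sup>2) = 1 \<and> quad (geg_G lam) I y = nu_tilde lam (m + 1)"
        unfolding nu_tilde_def by (rule spec(2)[OF _ le0 A_tilde_mat_eq[OF lam]]) (use m in simp)
    qed (use m in \<open>auto, presburger\<close>)
  qed
  note core = lam n I_def J_def M
  have "markov_const n lam = ereal (2 * sqrt M)" by (rule markov_const_eq[OF core])
  moreover have "(\<exists>\<theta> t. t n > 0 \<and> (\<forall>k\<in>{1..(n - 1) div 2}. t (n - 2 * k) \<ge> 0)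
            \<and> p = Polynomial.smult (exp (\<i> * complex_of_real \<theta>))
                    (\<Sum>k = 0..(n - 1) div 2.
                       Polynomial.smult (complex_of_real (t (n - 2 * k)))
                         (map_poly complex_of_real (gegenbauer lam (n - 2 * k)))))
        \<and> (even n \<longrightarrow> (\<forall>z. poly p (- z) = poly p z))
        \<and> (odd n \<longrightarrow> (\<forall>z. poly p (- z) = - poly p z))"
    if p: "extremal_poly n lam p" for p
  proof -
    obtain \<theta> s where s: "\<forall>j\<in>I. s j > 0"
      and ps: "p = Polynomial.smult (exp (\<i> * complex_of_real \<theta>))
            (\<Sum>j\<in>I. Polynomial.smult (complex_of_real (s j)) (cpoly (geg lam j)))"
      using extremal_poly_form[OF core p] by blast
    define c where "c = (if lam = 0 then 1 else lam)"
    have c: "c \<noteq> 0" by (simp add: c_def)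
    \<comment> \<open>For \<open>lam < 0\<close> the factor c is negative; its sign is absorbed by
      adding pi to the phase, and the coefficients are divided by |c|.\<close>
    obtain \<phi> where \<phi>: "exp (\<i> * complex_of_real \<theta>) = exp (\<i> * complex_of_real \<phi>) * complex_of_real (sgn c)"
    proof (cases "c > 0")
      case True
      then show ?thesis by (intro that[of \<theta>]) simp
    next
      case False
      then show ?thesis using c by (intro that[of "\<theta> + pi"]) (simp add: distrib_left exp_add)
    qed
    let ?t = "\<lambda>j. s j / \<bar>c\<bar>"
    have sgn: "sgn c * s j = ?t j * c" for j
      using c by (simp add: sgn_if)
    have inj: "inj_on (\<lambda>k. n - 2 * k) {0..(n - 1) div 2}" using n by (auto simp: inj_on_def)
    have I_image: "I = (\<lambda>k. n - 2 * k) ` {0..(n - 1) div 2}"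
      unfolding I_def by (rule parity_class_eq[OF n])
    have "p = Polynomial.smult (exp (\<i> * complex_of_real \<phi>))
            (\<Sum>j\<in>I. Polynomial.smult (complex_of_real (?t j)) (cpoly (gegenbauer lam j)))"
      unfolding ps smult_sum2 smult_smult
    proof (intro sum.cong refl)
      fix j assume "j \<in> I"
      then have g: "cpoly (gegenbauer lam j) = Polynomial.smult (complex_of_real c) (cpoly (geg lam j))"
        unfolding c_def by (intro cpoly_gegenbauer) (simp add: I_def)
      have "exp (\<i> * complex_of_real \<theta>) * complex_of_real (s j)
          = exp (\<i> * complex_of_real \<phi>) * complex_of_real (?t j * c)"
        unfolding \<phi> sgn[symmetric] by simp
      then show "Polynomial.smult (exp (\<i> * complex_of_real \<theta>) * complex_of_real (s j)) (cpoly (geg lam j))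
          = Polynomial.smult (exp (\<i> * complex_of_real \<phi>) * complex_of_real (?t j)) (cpoly (gegenbauer lam j))"
        unfolding g by (simp add: mult.assoc)
    qed
    also have "(\<Sum>j\<in>I. Polynomial.smult (complex_of_real (?t j)) (cpoly (gegenbauer lam j)))
        = (\<Sum>k = 0..(n - 1) div 2. Polynomial.smult (complex_of_real (?t (n - 2 * k))) (cpoly (gegenbauer lam (n - 2 * k))))"
      unfolding I_image by (simp only: sum.reindex[OF inj] o_def)
    finally have pt: "p = Polynomial.smult (exp (\<i> * complex_of_real \<phi>))
        (\<Sum>k = 0..(n - 1) div 2. Polynomial.smult (complex_of_real (?t (n - 2 * k))) (cpoly (gegenbauer lam (n - 2 * k))))" .
    have t: "?t j > 0" if "j \<in> I" for j using s c that by simp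
    have "n \<in> I" using n by (simp add: I_def)
    moreover have "n - 2 * k \<in> I" if "k \<in> {1..(n - 1) div 2}" for k
      using that unfolding I_image by auto
    ultimately have pos: "?t n > 0" "\<forall>k\<in>{1..(n - 1) div 2}. ?t (n - 2 * k) \<ge> 0"
      using t less_imp_le by blast+
    have par: "poly p (- z) = (- 1) ^ n * poly p z" for z
    proof -
      have "(- 1 :: complex) ^ j = (- 1) ^ n" if "j \<in> I" for j
        using that by (cases "even n") (auto simp: I_def)
      then show ?thesis
        unfolding ps by (simp add: poly_sum poly_cpoly_geg_minus sum_distrib_left mult_ac cong: sum.cong)
    qed
    show ?thesis
      by (intro conjI exI[of _ \<phi>] exI[of _ ?t]) (rule pos(1), rule pos(2), rule pt, (simp add: par)+)
  qed
  ultimately show ?thesis using nu by blast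
qed

end
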